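(* Let $\{D_1,\dots,D_m\}$ be a nontrivial $(v,m,k,\lambda)$-SEDF in a finite abelian group $G$ with $m>2$, let $D=\bigcup_{i=1}^mD_i$, and let $p$ be a prime divisor of $v$, with $G_p$ the Sylow $p$-subgroup of $G$. Let $(a_1,b_1),\dots,(a_t,b_t)$ be pairs of integers with $b_i>a_i>0$ and $\gcd(a_i,b_i)=1$, and suppose $(a_\chi,b_\chi)\in\{(a_i,b_i):1\le i\le t\}$ for every $\chi\in\widehat{G}^N$. Then either both of the following hold: (1a) $|G_p|$ divides $km$; (1b) $k^2+(|G_p|-1)\lambda=|G_p|r_1$ for some integer $r_1\ge k$; or, for some $i$ with $1\le i\le t$, all of the following hold: (2a) $k^2m^2+(p-1)\frac{4a_i^2\lambda}{b_i^2-a_i^2}=pr_{2,i}$ for some integer $r_{2,i}\ge km$; (2b) $k^2+(p-1)\frac{(b_i-a_i)\lambda}{b_i+a_i}=pr_{3,i}$ for some integer $r_{3,i}\ge k$; (2c) $k^2+(p-1)\frac{(b_i+a_i)\lambda}{b_i-a_i}=pr_{4,i}$ for some integer $r_{4,i}$.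
   Context: Groups are finite abelian, written multiplicatively with identity $1$. For a subset $A\subseteq G$ we also write $A$ for $\sum_{a\in A}a\in\mathbb{Z}[G]$ and $A^{(-1)}=\sum_{a\in A}a^{-1}$. Given integers $m\ge 2$, $k\ge1$, $\lambda\ge 1$ and a group $G$ of order $v$, mutually disjoint $k$-subsets $D_1,\dots,D_m$ form a $(v,m,k,\lambda)$-SEDF in $G$ if $D_j\sum_{i\ne j}D_i^{(-1)}=\lambda(G-1)$ in $\mathbb{Z}[G]$ for each $j$; nontrivial means $k>1$. $\widehat{G}$ is the character group, characters extended linearly to $\mathbb{Z}[G]$. $\widehat{G}^N$ is the set of nonprincipal $\chi$ with $\chi(D)\ne0$. For a nontrivial SEDF with $m>2$ and $\chi\in\widehat{G}^N$, $\sqrt{1+4\lambda/|\chi(D)|^2}$ is rational; write it $b_\chi/a_\chi$ with integers $b_\chi>a_\chi>0$, $\gcd(a_\chi,b_\chi)=1$. *)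

theory Defs
  imports Complex_Main "HOL-Algebra.Coset" "HOL-Computational_Algebra.Primes"
begin

text \<open>An element of the integral group ring of a finite group \<open>G\<close> is represented by its coefficient
  function; only the values on \<open>carrier G\<close> matter. The product is convolution.\<close>

definition gr_of_set :: "'a set \<Rightarrow> 'a \<Rightarrow> int" where
  "gr_of_set A = (\<lambda>g. of_bool (g \<in> A))"

definition gr_of_set_inv :: "('a, 'b) monoid_scheme \<Rightarrow> 'a set \<Rightarrow> 'a \<Rightarrow> int" where
  "gr_of_set_inv G A = (\<lambda>g. \<Sum>a\<in>A. of_bool (g = inv\<^bsub>G\<^esub> a))"

definition gr_mult :: "('a, 'b) monoid_scheme \<Rightarrow> ('a \<Rightarrow> int) \<Rightarrow> ('a \<Rightarrow> int) \<Rightarrow> 'a \<Rightarrow> int" where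
  "gr_mult G f h = (\<lambda>g. \<Sum>x\<in>carrier G. f x * h (inv\<^bsub>G\<^esub> x \<otimes>\<^bsub>G\<^esub> g))"

definition SEDF ::
  "('a, 'b) monoid_scheme \<Rightarrow> nat \<Rightarrow> nat \<Rightarrow> nat \<Rightarrow> nat \<Rightarrow> (nat \<Rightarrow> 'a set) \<Rightarrow> bool" where
  "SEDF G v m k lam D \<longleftrightarrow>
     m \<ge> 2 \<and> k \<ge> 1 \<and> lam \<ge> 1 \<and> order G = v \<and>
     (\<forall>i\<in>{1..m}. D i \<subseteq> carrier G \<and> card (D i) = k) \<and>
     (\<forall>i\<in>{1..m}. \<forall>j\<in>{1..m}. i \<noteq> j \<longrightarrow> D i \<inter> D j = {}) \<and>
     (\<forall>j\<in>{1..m}. \<forall>g\<in>carrier G.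
        gr_mult G (gr_of_set (D j)) (\<lambda>h. \<Sum>i\<in>{1..m} - {j}. gr_of_set_inv G (D i) h) g
        = int lam * (gr_of_set (carrier G) g - gr_of_set {\<one>\<^bsub>G\<^esub>} g))"

definition complex_units :: "complex monoid" where
  "complex_units = \<lparr>carrier = UNIV - {0}, monoid.mult = (*), one = 1\<rparr>"

definition characters :: "('a, 'b) monoid_scheme \<Rightarrow> ('a \<Rightarrow> complex) set" where
  "characters G = hom G complex_units \<inter> extensional (carrier G)"

definition principal_character :: "('a, 'b) monoid_scheme \<Rightarrow> 'a \<Rightarrow> complex" where
  "principal_character G = (\<lambda>g\<in>carrier G. 1)"

definition char_ext :: "('a, 'b) monoid_scheme \<Rightarrow> ('a \<Rightarrow> complex) \<Rightarrow> ('a \<Rightarrow> int) \<Rightarrow> complex" where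
  "char_ext G \<chi> f = (\<Sum>g\<in>carrier G. of_int (f g) * \<chi> g)"

definition nonvanishing_characters :: "('a, 'b) monoid_scheme \<Rightarrow> 'a set \<Rightarrow> ('a \<Rightarrow> complex) set" where
  "nonvanishing_characters G E =
     {\<chi> \<in> characters G. \<chi> \<noteq> principal_character G \<and> char_ext G \<chi> (gr_of_set E) \<noteq> 0}"

text \<open>The pair \<open>(a\<^sub>\<chi>, b\<^sub>\<chi>)\<close>. It is at most one pair by coprimality and positivity. If \<open>E\<close> is the union of
  a nontrivial SEDF with more than two blocks and \<open>\<chi>\<close> is nonprincipal with \<open>\<chi>(E) \<noteq> 0\<close>, it exists.\<close>

definition char_pair :: "('a, 'b) monoid_scheme \<Rightarrow> nat \<Rightarrow> 'a set \<Rightarrow> ('a \<Rightarrow> complex) \<Rightarrow> int \<times> int" where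
  "char_pair G lam E \<chi> =
     (THE (a, b). 0 < a \<and> a < b \<and> coprime a b \<and>
        sqrt (1 + 4 * real lam / (cmod (char_ext G \<chi> (gr_of_set E)))\<^sup>2) = real_of_int b / real_of_int a)"

definition sylow_subgroup :: "('a, 'b) monoid_scheme \<Rightarrow> nat \<Rightarrow> 'a set \<Rightarrow> bool" where
  "sylow_subgroup G p P \<longleftrightarrow> subgroup P G \<and> card P = p ^ multiplicity p (order G)"

end

(*  A nonprincipal character \<chi> turns the SEDF equations into s_j * cnj (S - s_j) = - \<lambda> with s_j = \<chi>(D_j)
    and S = \<chi>(D). If S = 0, then |s_j|^2 = \<lambda> for all j; otherwise |S|^2, and both values taken by
    |s_j|^2, are rational functions of \<lambda> and the pair (a_\<chi>, b_\<chi>).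

    Consider the characters of p-power order; they are the characters of G_p. If all nonprincipal ones
    vanish on D, orthogonality over them gives (1a) and (1b). If some \<chi> does not, then |\<chi>(E)|^2 is a
    rational number for E = D and for suitable blocks E = D_j of both kinds. It is also an integer
    combination of p^e-th roots of unity, whose coefficients count the pairs (x, y) in E with a given
    \<chi>(x y^-1). Since the p^e-th cyclotomic polynomial is irreducible, these coefficients, apart from the
    one of 1, are constant on cosets of the subgroup of order p, and counting all pairs yields
    |E|^2 + (p - 1) |\<chi>(E)|^2 = p r with r >= |E|.  *)

theory Submission
  imports Defs "HOL-Algebra.Multiplicative_Group" "HOL-Computational_Algebra.Polynomial"
begin

hide_const (open) Polynomial.order

section \<open>Integer relations between roots of unity of prime power order\<close>

abbreviation eval_int :: "int poly \<Rightarrow> complex \<Rightarrow> complex" where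
  "eval_int f z \<equiv> poly (map_poly of_int f) z"

lemma eval_int_add: "eval_int (f + g) z = eval_int f z + eval_int g z"
proof -
  have "map_poly of_int (f + g) = (map_poly of_int f + map_poly of_int g :: complex poly)"
    by (rule poly_eqI) (simp add: coeff_map_poly)
  then show ?thesis by simp
qed

lemma eval_int_pCons: "eval_int (pCons c f) z = of_int c + z * eval_int f z"
  by (simp add: map_poly_pCons)

lemma eval_int_smult: "eval_int (smult c f) z = of_int c * eval_int f z"
  by (induction f) (simp_all add: eval_int_pCons algebra_simps)

lemma eval_int_mult: "eval_int (f * g) z = eval_int f z * eval_int g z"
  by (induction f) (simp_all add: eval_int_pCons eval_int_smult eval_int_add algebra_simps)

lemma eval_int_pcompose: "eval_int (pcompose f g) z = eval_int f (eval_int g z)"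
  by (induction f)
    (simp_all add: pcompose_pCons eval_int_pCons eval_int_mult eval_int_add algebra_simps)

section \<open>Eisenstein's criterion and annihilators of least degree\<close>

text \<open>Unless \<open>f\<close> is constant, \<open>p\<close> divides the constant coefficient
  of exactly one factor. At the least index \<open>i\<close> where \<open>p\<close> fails to divide
  a coefficient of that factor, the coefficient of the product is not divisible by \<open>p\<close>
  either. This forces \<open>i\<close> to be the degree of \<open>f\<close>, which leaves the other
  factor constant.\<close>

lemma eisenstein:
  fixes p :: int and g h :: "int poly"
  defines "f \<equiv> g * h"
  assumes p: "prime p"
    and mid: "\<And>i. i < degree f \<Longrightarrow> p dvd coeff f i" and lead: "\<not> p dvd lead_coeff f"
    and const: "\<not> p\<^sup>2 dvd coeff f 0"
  shows "degree g = 0 \<or> degree h = 0"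
proof -
  have "f \<noteq> 0" using lead by auto
  then have deg: "degree f = degree g + degree h"
    unfolding f_def by (intro degree_mult_eq) auto
  have "lead_coeff f = lead_coeff g * lead_coeff h"
    unfolding f_def by (rule lead_coeff_mult)
  then have lcn: "\<not> p dvd lead_coeff g" "\<not> p dvd lead_coeff h"
    using lead by (auto intro: dvd_mult dvd_mult2)
  have key: "degree v = 0"
    if eq: "f = u * v" and u: "p dvd coeff u 0" "\<not> p dvd lead_coeff u"
      and v: "\<not> p dvd coeff v 0" and deg: "degree f = degree u + degree v"
    for u v :: "int poly"
  proof -
    define i where "i = (LEAST i. \<not> p dvd coeff u i)"
    have i: "\<not> p dvd coeff u i" unfolding i_def by (rule LeastI) (rule u(2))
    have less: "p dvd coeff u j" if "j < i" for j
      using not_less_Least[of j "\<lambda>i. \<not> p dvd coeff u i"] that by (auto simp: i_def)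
    have "i \<le> degree u" unfolding i_def by (rule Least_le) (rule u(2))
    have e: "coeff f i = (\<Sum>j<i. coeff u j * coeff v (i - j)) + coeff u i * coeff v 0"
      unfolding eq coeff_mult by (simp add: lessThan_Suc_atMost [symmetric])
    have "p dvd (\<Sum>j<i. coeff u j * coeff v (i - j))"
      by (rule dvd_sum) (use less in auto)
    moreover have "\<not> p dvd coeff u i * coeff v 0"
      using i v p by (simp add: prime_dvd_mult_iff)
    ultimately have "\<not> p dvd coeff f i"
      unfolding e by (simp add: dvd_add_right_iff)
    then have "\<not> i < degree f" using mid by blast
    then show ?thesis using \<open>i \<le> degree u\<close> deg by simp
  qed
  have c0: "coeff f 0 = coeff g 0 * coeff h 0"
    unfolding f_def by (rule coeff_mult_0)
  show ?thesis
  proof (cases "degree f = 0")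
    case True then show ?thesis using deg by simp
  next
    case False
    then have "p dvd coeff g 0 * coeff h 0" using mid[of 0] c0 by simp
    moreover have "\<not> (p dvd coeff g 0 \<and> p dvd coeff h 0)"
      using const unfolding c0 power2_eq_square by (auto intro: mult_dvd_mono)
    ultimately consider "p dvd coeff g 0" "\<not> p dvd coeff h 0" | "p dvd coeff h 0" "\<not> p dvd coeff g 0"
      using p by (auto simp: prime_dvd_mult_iff)
    then show ?thesis
    proof cases
      case 1 then show ?thesis using key[of g h] lcn deg by (simp add: f_def)
    next
      case 2 then show ?thesis using key[of h g] lcn deg by (simp add: f_def mult.commute add.commute)
    qed
  qed
qed

text \<open>An annihilating polynomial of least degree that is primitive divides \<open>f\<close> over the integers, by
  pseudo-division and Gauss's lemma; so Eisenstein's criterion makes it as long as \<open>f\<close>.\<close>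
lemma eisenstein_degree_le:
  fixes p :: int and f g :: "int poly"
  assumes p: "prime p"
    and mid: "\<And>i. i < degree f \<Longrightarrow> p dvd coeff f i" and lead: "\<not> p dvd lead_coeff f"
    and const: "\<not> p\<^sup>2 dvd coeff f 0"
    and fz: "eval_int f z = 0" and gz: "eval_int g z = 0" and g0: "g \<noteq> 0"
  shows "degree f \<le> degree g"
proof -
  obtain h0 where h0: "h0 \<noteq> 0 \<and> eval_int h0 z = 0"
    and h0min: "\<And>h. h \<noteq> 0 \<and> eval_int h z = 0 \<Longrightarrow> degree h0 \<le> degree h"
    using ex_has_least_nat[of "\<lambda>h. h \<noteq> 0 \<and> eval_int h z = 0" g degree] g0 gz by blast
  define h where "h = primitive_part h0"
  have dh: "degree h = degree h0" by (simp add: h_def)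
  have h: "h \<noteq> 0" using h0 by (simp add: h_def)
  have hz: "eval_int h z = 0"
    using eval_int_smult[of "content h0" h z] h0 by (auto simp: h_def)
  have ch: "content h = 1" using h0 by (simp add: h_def)
  obtain a q where a: "a \<noteq> 0" and aq: "smult a f = h * q + pseudo_mod f h"
    using pseudo_mod(1)[OF h] by blast
  have "eval_int (smult a f) z = eval_int (h * q + pseudo_mod f h) z" using aq by (rule arg_cong)
  then have "eval_int (pseudo_mod f h) z = 0"
    using hz fz by (simp add: eval_int_add eval_int_mult eval_int_smult)
  then have "pseudo_mod f h = 0"
    using pseudo_mod(2)[OF h, of f] h0min[of "pseudo_mod f h"] dh by (simp, linarith)
  then have aq: "smult a f = h * q" using aq by simp
  have f0: "f \<noteq> 0" using lead by auto
  \<comment> \<open>As \<open>h\<close> has content 1, Gauss's lemma puts the whole multiplier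
    \<open>a\<close> of the pseudo-division into the content of \<open>q\<close>, so it
    cancels.\<close>
  have "content (smult a f) = content q" unfolding aq by (simp add: content_mult ch)
  then have "a dvd content q" by (metis content_smult dvd_triv_left normalize_dvd_iff dvd_trans dvd_normalize_iff)
  then have "[:a:] dvd q" by (simp add: const_poly_dvd_iff_dvd_content)
  then obtain q' where q': "q = smult a q'" by (auto elim!: dvdE)
  have "smult a f = smult a (h * q')" using aq q' by simp
  then have f: "f = h * q'" by (rule smult_cancel[OF a])
  then have "degree h = 0 \<or> degree q' = 0"
    using eisenstein[OF p, of h q'] mid lead const by simp
  moreover have "degree h \<noteq> 0"
  proof
    assume "degree h = 0"
    then obtain c where "h = [:c:]" by (rule degree_eq_zeroE)
    then show False using hz h by (simp add: map_poly_pCons)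
  qed
  ultimately have "degree f = degree h"
    using f f0 by (simp add: degree_mult_eq)
  then show ?thesis using h0min[of g] g0 gz dh by simp
qed

section \<open>Cyclotomic polynomials of prime power order\<close>

lemma eval_int_power: "eval_int (f ^ n) z = eval_int f z ^ n"
  by (induction n) (simp_all add: eval_int_mult)

lemma eval_int_sum: "eval_int (\<Sum>i\<in>I. f i) z = (\<Sum>i\<in>I. eval_int (f i) z)"
  by (induction I rule: infinite_finite_induct) (simp_all add: eval_int_add)

lemma eval_int_monom: "eval_int (monom c n) z = of_int c * z ^ n"
  by (simp add: map_poly_monom poly_monom)

text \<open>From \<open>i * (p ^ n choose i) = p ^ n * (p ^ n - 1 choose i - 1)\<close>: if
  \<open>p\<close> did not divide the binomial coefficient, all of \<open>p ^ n\<close> would have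
  to divide \<open>i\<close>, which is too small.\<close>

lemma prime_power_dvd_choose:
  assumes "prime (p::nat)" "0 < i" "i < p ^ n"
  shows "p dvd (p ^ n choose i)"
proof (rule ccontr)
  assume "\<not> p dvd (p ^ n choose i)"
  then have "coprime (p ^ n) (p ^ n choose i)"
    using assms(1) by (simp add: prime_imp_coprime)
  moreover have "p ^ n dvd i * (p ^ n choose i)"
    using times_binomial_minus1_eq[OF assms(2), of "p ^ n"] by simp
  ultimately have "p ^ n dvd i" by (simp add: coprime_dvd_mult_left_iff)
  then show False using assms(2,3) by (auto dest: dvd_imp_le)
qed

lemma linear_power_minus_1:
  assumes "n > 0"
  shows "degree ([:1, 1:] ^ n - 1 :: int poly) = n" "lead_coeff ([:1, 1:] ^ n - 1 :: int poly) = 1"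
proof -
  have "coeff ([:1, 1:] ^ n - 1 :: int poly) n = 1"
    using assms by (simp add: coeff_linear_power)
  moreover have "degree ([:1, 1:] ^ n - 1 :: int poly) \<le> n"
    by (rule degree_diff_le) (simp_all add: degree_linear_power)
  ultimately show "degree ([:1, 1:] ^ n - 1 :: int poly) = n"
    by (metis le_antisym le_degree zero_neq_one)
  with \<open>coeff _ n = 1\<close> show "lead_coeff ([:1, 1:] ^ n - 1 :: int poly) = 1" by simp
qed

text \<open>The Frobenius congruence modulo \<open>p\<close>: only the inner binomial coefficients
  survive the subtraction.\<close>

lemma prime_dvd_linear_power:
  assumes "prime p"
  shows "[:int p:] dvd [:1, 1:] ^ (p ^ n) - 1 - monom 1 (p ^ n)"
proof -
  have "int p dvd coeff ([:1, 1:] ^ (p ^ n) - 1 - monom 1 (p ^ n)) i" for i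
  proof -
    consider "i = 0" | "0 < i" "i < p ^ n" | "i = p ^ n" "i > 0" | "i > p ^ n" by linarith
    then show ?thesis
    proof cases
      case 1
      then show ?thesis using assms
        by (simp add: coeff_linear_poly_power prime_gt_0_nat)
    next
      case 2
      then show ?thesis using prime_power_dvd_choose[OF assms 2]
        by (simp add: coeff_linear_poly_power)
    next
      case 3
      then show ?thesis by (simp add: coeff_linear_power)
    next
      case 4
      then have "coeff ([:1, 1:] ^ (p ^ n) :: int poly) i = 0"
        by (intro coeff_eq_0) (simp add: degree_linear_power)
      then show ?thesis using 4 by simp
    qed
  qed
  then show ?thesis by (simp add: const_poly_dvd_iff)
qed

text \<open>The cyclotomic polynomial is Eisenstein in the variable \<open>x - 1\<close>.\<close>
lemma prime_power_root_annihilator: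
  assumes p: "prime p" and z1: "z ^ (p ^ e * p) = 1" and z2: "z ^ (p ^ e) \<noteq> 1"
    and fz: "eval_int f z = 0" and deg: "degree f < p ^ e * (p - 1)"
  shows "f = 0"
proof (rule ccontr)
  assume f: "f \<noteq> 0"
  define q where "q = p ^ e"
  define L :: "int poly" where "L = [:1, 1:]"
  \<comment> \<open>\<open>F\<close> is the cyclotomic polynomial of order
    \<open>p ^ (e + 1)\<close> with \<open>x + 1\<close> in place of \<open>x\<close>; it has the
    root \<open>z - 1\<close>.\<close>
  define F where "F = (\<Sum>j<p. (L ^ q) ^ j)"
  have p0: "p > 0" and q0: "q > 0" using p by (auto simp: q_def prime_gt_0_nat)
  have eL: "eval_int (L ^ n) (z - 1) = z ^ n" for n
    by (simp add: L_def eval_int_power map_poly_pCons)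
  have FL: "F * (L ^ q - 1) = L ^ (q * p) - 1"
    using power_diff_1_eq[of "L ^ q" p] unfolding F_def power_mult by (simp only: mult.commute)
  have FL': "degree (L ^ q - 1) = q" "lead_coeff (L ^ q - 1) = 1"
      "degree (L ^ (q * p) - 1) = q * p" "lead_coeff (L ^ (q * p) - 1) = 1"
    unfolding L_def using linear_power_minus_1[of q] linear_power_minus_1[of "q * p"] p0 q0 by simp_all
  have lc: "lead_coeff F = 1"
    using arg_cong[OF FL, of lead_coeff] FL' by (simp add: lead_coeff_mult)
  then have "degree (F * (L ^ q - 1)) = degree F + q"
    using FL'(1,2) by (subst degree_mult_eq) auto
  then have dF: "degree F = q * (p - 1)"
    using FL FL'(3) by (simp add: diff_mult_distrib2)
  have "eval_int F (z - 1) * (z ^ q - 1) = 0"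
  proof -
    have "eval_int F (z - 1) = (\<Sum>j<p. (z ^ q) ^ j)"
      by (simp add: F_def eval_int_sum eL power_mult[symmetric])
    then show ?thesis
      using power_diff_1_eq[of "z ^ q" p] z1
    by (simp add: q_def mult.commute[of "z ^ _ - 1"] flip: power_mult)
  qed
  then have Fz: "eval_int F (z - 1) = 0" using z2 by (simp add: q_def)
  have "[:int p:] dvd L ^ q - 1 - monom 1 q" "[:int p:] dvd L ^ (q * p) - 1 - monom 1 (q * p)"
    using prime_dvd_linear_power[OF p, of e] prime_dvd_linear_power[OF p, of "Suc e"]
    by (simp_all add: q_def L_def mult.commute)
  \<comment> \<open>Modulo \<open>p\<close> the identity \<open>FL\<close> reads
    \<open>F * x ^ q = x ^ (q * p)\<close>, so \<open>F\<close> is congruent to its leading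
    term.\<close>
  then have "[:int p:] dvd (L ^ (q * p) - 1 - monom 1 (q * p)) - F * (L ^ q - 1 - monom 1 q)"
    by (rule dvd_diff[OF _ dvd_mult, rotated])
  also have "\<dots> = monom 1 q * F - monom 1 (q * p)"
    using FL by (simp add: algebra_simps)
  finally have dvd: "[:int p:] dvd monom 1 q * F - monom 1 (q * p)" .
  have mid: "int p dvd coeff F i" if "i < degree F" for i
  proof -
    have "i + q \<noteq> q * p" using that p0 unfolding dF by (cases p) auto
    then show ?thesis using dvd[unfolded const_poly_dvd_iff, rule_format, of "i + q"]
      by (simp add: coeff_monom_mult)
  qed
  have "coeff F 0 = int p"
    unfolding poly_0_coeff_0[symmetric] by (simp add: F_def L_def poly_sum poly_power)
  then have const: "\<not> (int p)\<^sup>2 dvd coeff F 0"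
    using p by (auto simp: power2_eq_square dest!: zdvd_imp_le prime_gt_1_nat)
  \<comment> \<open>Shifting the variable carries \<open>f\<close> to an annihilator of
    \<open>z - 1\<close> of the same degree, to which the degree bound for \<open>F\<close>
    applies.\<close>
  have "eval_int (pcompose f L) (z - 1) = 0"
    using fz by (simp add: eval_int_pcompose L_def map_poly_pCons)
  moreover have "pcompose f L \<noteq> 0" using f by (simp add: pcompose_eq_0_iff L_def)
  moreover have "\<not> int p dvd lead_coeff F" using lc p by (auto simp: prime_gt_1_nat)
  ultimately have "degree F \<le> degree (pcompose f L)"
    using p mid const Fz by (intro eisenstein_degree_le[of "int p" F "z - 1"]) auto
  also have "\<dots> = degree f" by (simp add: L_def degree_pcompose)
  finally show False using deg dF q_def by simp
qed

section \<open>Integer relations and periodic coefficients\<close>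

text \<open>Cutting the range into \<open>p\<close> blocks of length \<open>q\<close> splits off a
  geometric series. It vanishes at the roots of unity considered below and equals \<open>p\<close>
  at \<open>z = 1\<close>; both cases are used.\<close>

lemma sum_periodic:
  fixes z :: "'a::comm_ring_1"
  shows "(\<Sum>i<p * q. h (i mod q) * z ^ i) = (\<Sum>c<q. h c * z ^ c) * (\<Sum>j<p. (z ^ q) ^ j)"
proof -
  have "(\<Sum>i\<in>{j * q..<j * q + q}. h (i mod q) * z ^ i) = (\<Sum>c<q. h c * z ^ c) * (z ^ q) ^ j" for j
  proof -
    have "(\<Sum>i\<in>{j * q..<j * q + q}. h (i mod q) * z ^ i)
        = (\<Sum>c\<in>{0..<q}. h ((c + j * q) mod q) * z ^ (c + j * q))"
      using sum.shift_bounds_nat_ivl[of "\<lambda>i. h (i mod q) * z ^ i" 0 "j * q" q]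
      by (simp add: add.commute)
    also have "\<dots> = (\<Sum>c\<in>{0..<q}. h c * z ^ c * (z ^ q) ^ j)"
      by (intro sum.cong) (auto simp: power_add power_mult mult.commute[of _ q] mult.assoc)
    finally show ?thesis by (simp add: sum_distrib_right atLeast0LessThan)
  qed
  then show ?thesis
    by (simp add: sum.nat_group [symmetric] sum_distrib_left)
qed

text \<open>Sums with coefficients of period \<open>p ^ e\<close> vanish at \<open>z\<close>.
  Subtracting the periodic sequence that agrees with \<open>f\<close> on the last block leaves a
  relation of degree below that of the cyclotomic polynomial, hence the zero relation.\<close>

lemma prime_power_root_relation:
  fixes f :: "nat \<Rightarrow> int"
  assumes p: "prime p" and z1: "z ^ (p ^ e * p) = 1" and z2: "z ^ (p ^ e) \<noteq> 1"
    and sum0: "(\<Sum>i<p * p ^ e. of_int (f i) * z ^ i) = (0 :: complex)"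
    and i: "i < p * p ^ e"
  shows "f i = f (i mod p ^ e + p ^ e * (p - 1))"
proof -
  define q where "q = p ^ e"
  define d where "d = q * (p - 1)"
  define g where "g i = f i - f (i mod q + d)" for i
  have p1: "p > 1" using p by (rule prime_gt_1_nat)
  then have q0: "q > 0" by (simp add: q_def)
  have d0: "d > 0" using p1 q0 by (simp add: d_def)
  have dle: "d \<le> p * q" by (simp add: d_def)
  have "(\<Sum>j<p. (z ^ q) ^ j) * (z ^ q - 1) = 0"
    using power_diff_1_eq[of "z ^ q" p] z1
    by (simp add: q_def mult.commute[of "z ^ _ - 1"] flip: power_mult)
  then have "(\<Sum>j<p. (z ^ q) ^ j) = 0" using z2 by (simp add: q_def)
  then have "(\<Sum>i<p * q. of_int (f (i mod q + d)) * z ^ i) = 0"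
    using sum_periodic[where h = "\<lambda>c. of_int (f (c + d))" and z = z and p = p and q = q] by simp
  then have "0 = (\<Sum>i<p * q. of_int (g i) * z ^ i)"
    using sum0 by (simp add: g_def q_def algebra_simps sum_subtractf)
  \<comment> \<open>On the last block \<open>i mod q + d\<close> is \<open>i\<close> itself, so no
    terms remain from \<open>d\<close> on.\<close>
  also have g0: "g i = 0" if "d \<le> i" "i < p * q" for i
  proof -
    have "(i - d) div q = 0" "i = (i - d) + q * (p - 1)"
      using that p1 q0 by (auto simp: d_def algebra_simps diff_mult_distrib2)
    then have "i mod q = i - d" using that
      by (metis div_eq_0_iff mod_less mod_mult_self2 not_less0 q0)
    then show ?thesis using that by (simp add: g_def)
  qed
  have "(\<Sum>i<p * q. of_int (g i) * z ^ i) = (\<Sum>i<d. of_int (g i) * z ^ i)"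
    by (rule sum.mono_neutral_right) (use dle g0 in auto)
  also have "\<dots> = eval_int (\<Sum>i<d. monom (g i) i) z"
    by (simp add: eval_int_sum eval_int_monom)
  finally have "eval_int (\<Sum>i<d. monom (g i) i) z = 0" by simp
  moreover have "degree (\<Sum>i<d. monom (g i) i) < d"
    by (rule degree_sum_less) (use d0 le_less_trans[OF degree_monom_le] in auto)
  ultimately have poly0: "(\<Sum>i<d. monom (g i) i) = 0"
    using prime_power_root_annihilator[OF p z1 z2] by (simp add: d_def q_def)
  have "g i = 0" if "i < d" for i
    using arg_cong[OF poly0, of "\<lambda>f. coeff f i"] that by (simp add: coeff_sum)
  then have "g i = 0" using g0[of i] i by (cases "i < d") (auto simp: q_def)
  then show ?thesis by (simp add: g_def d_def q_def)
qed

text \<open>Stated for an arbitrary finite set, this serves the union of the SEDF and its single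
  blocks alike. Rationality of the squared norm turns its expansion in roots of unity into an
  integer relation.\<close>

lemma rational_norm_prime_power_character_sum:
  fixes \<chi> :: "'a \<Rightarrow> complex"
  assumes p: "prime p" and fin: "finite E" and roots: "\<And>x. x \<in> E \<Longrightarrow> \<chi> x ^ (p ^ e) = 1"
    and rat: "(cmod (\<Sum>x\<in>E. \<chi> x))\<^sup>2 \<in> \<rat>"
  shows "\<exists>r::int. r \<ge> int (card E) \<and>
    (real (card E))\<^sup>2 + (real p - 1) * (cmod (\<Sum>x\<in>E. \<chi> x))\<^sup>2 = real p * of_int r"
proof -
  define q where "q = p ^ e"
  define n where "n = (cmod (\<Sum>x\<in>E. \<chi> x))\<^sup>2"
  \<comment> \<open>The order of \<open>z\<close> is \<open>p ^ (e + 1)\<close>, one power of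
    \<open>p\<close> above the exponent of the values of \<open>\<chi>\<close>, so that the relation
    lemma also covers \<open>e = 0\<close>.\<close>
  define z where "z = cis (2 * pi / (p * q))"
  have p1: "p > 1" using p by (rule prime_gt_1_nat)
  then have q0: "q > 0" by (simp add: q_def)
  have pq: "p * q > 0" "1 < p * q" using p1 q0 less_le_trans[of 1 p "p * q"] by auto
  have zk: "z ^ k = cis (2 * pi * real k / real (p * q))" for k
    by (simp add: z_def DeMoivre mult_ac)
  have bij: "bij_betw (\<lambda>k. z ^ k) {..<p * q} {w. w ^ (p * q) = 1}"
    using bij_betw_roots_unity[OF pq(1)] by (simp only: zk)
  then have "z ^ 1 \<in> {w. w ^ (p * q) = 1}" using pq bij_betwE by blast
  then have z1: "z ^ (p ^ e * p) = 1" by (simp add: q_def mult.commute)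
  have z2: "z ^ (p ^ e) \<noteq> 1"
  proof
    assume "z ^ (p ^ e) = 1"
    then have "z ^ q = z ^ 0" by (simp add: q_def)
    moreover have "q \<in> {..<p * q}" "0 \<in> {..<p * q}" using p1 q0 by auto
    ultimately have "q = 0" using bij unfolding bij_betw_def by (meson inj_onD)
    then show False using q0 by simp
  qed
  have norm1: "cmod (\<chi> x) = 1" if "x \<in> E" for x
    using power_eq_imp_eq_norm[of "\<chi> x" "p ^ e" 1] roots[OF that] p1 by simp
  \<comment> \<open>Discrete logarithms to base \<open>z\<close>; the bound \<open>p * q\<close>
    makes them unique.\<close>
  define ind where "ind = (\<lambda>(x, y). SOME k. k < p * q \<and> z ^ k = \<chi> x * cnj (\<chi> y))"
  have ind: "ind (x, y) < p * q \<and> z ^ ind (x, y) = \<chi> x * cnj (\<chi> y)" if "x \<in> E" "y \<in> E" for x y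
  proof -
    have "(\<chi> x * cnj (\<chi> y)) ^ (p * q) = 1"
      using roots[OF that(1)] roots[OF that(2)]
      by (simp add: q_def power_mult_distrib mult.commute[of p] power_mult flip: complex_cnj_power)
    then obtain k where "k < p * q \<and> z ^ k = \<chi> x * cnj (\<chi> y)"
      using bij_betw_imp_surj_on[OF bij] by (smt (verit) imageE lessThan_iff mem_Collect_eq)
    then show ?thesis unfolding ind_def prod.case by (rule someI)
  qed
  define N where "N c = card {w \<in> E \<times> E. ind w = c}" for c
  have N: "(\<Sum>w\<in>E \<times> E. h (ind w)) = (\<Sum>c<p * q. of_nat (N c) * h c)" for h :: "nat \<Rightarrow> complex"
  proof -
    have "(\<Sum>w\<in>E \<times> E. h (ind w)) = (\<Sum>c<p * q. \<Sum>w | w \<in> E \<times> E \<and> ind w = c. h (ind w))"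
      by (rule sum.group [symmetric]) (use fin ind in auto)
    also have "\<dots> = (\<Sum>c<p * q. of_nat (N c) * h c)"
      by (intro sum.cong) (simp_all add: N_def)
    finally show ?thesis .
  qed
  have nsum: "complex_of_real n = (\<Sum>c<p * q. of_nat (N c) * z ^ c)"
  proof -
    have "complex_of_real n = (\<Sum>x\<in>E. \<chi> x) * cnj (\<Sum>x\<in>E. \<chi> x)"
      unfolding n_def by (simp only: complex_norm_square)
    also have "\<dots> = (\<Sum>(x, y)\<in>E \<times> E. \<chi> x * cnj (\<chi> y))"
      by (simp add: sum_product sum.cartesian_product)
    also have "\<dots> = (\<Sum>w\<in>E \<times> E. z ^ ind w)"
      by (intro sum.cong) (use ind in auto)
    finally show ?thesis by (simp only: N)
  qed
  have "complex_of_nat ((card E)\<^sup>2) = complex_of_nat (\<Sum>c<p * q. N c)"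
    using N[of "\<lambda>_. 1"] by (simp add: card_cartesian_product power2_eq_square)
  then have csum: "(card E)\<^sup>2 = (\<Sum>c<p * q. N c)" by (simp only: of_nat_eq_iff)
  \<comment> \<open>The diagonal pairs all have logarithm 0; this is the source of the lower bound
    on \<open>r\<close>.\<close>
  have N0: "card E \<le> N 0"
  proof -
    have "ind (x, x) = 0" if "x \<in> E" for x
    proof -
      have "z ^ ind (x, x) = z ^ 0" "ind (x, x) \<in> {..<p * q}" "0 \<in> {..<p * q}"
        using ind[OF that that] norm1[OF that] pq complex_norm_square[of "\<chi> x"]
        by auto
      then show ?thesis using bij unfolding bij_betw_def by (meson inj_onD)
    qed
    then have "(\<lambda>x. (x, x)) ` E \<subseteq> {w \<in> E \<times> E. ind w = 0}" by auto
    then have "card ((\<lambda>x. (x, x)) ` E) \<le> N 0"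
      unfolding N_def by (rule card_mono[rotated]) (use fin in auto)
    then show ?thesis by (simp add: card_image inj_on_def)
  qed
  obtain u w :: int where w: "w > 0" and uw: "n = u / w"
    using rat unfolding n_def by (rule Rats_cases')
  define d where "d = q * (p - 1)"
  \<comment> \<open>Multiplying \<open>n = u / w\<close> by the denominator gives an integer
    relation, with \<open>u\<close> moved into the coefficient of \<open>z ^ 0\<close>.\<close>
  define f where "f c = w * int (N c) - (if c = 0 then u else 0)" for c
  define K where "K c = N (c + d)" for c
  have d0: "d > 0" using p1 q0 by (simp add: d_def)
  have "(\<Sum>c<p * q. of_int (f c) * z ^ c)
      = of_int w * (\<Sum>c<p * q. of_nat (N c) * z ^ c) - (\<Sum>c<p * q. if c = 0 then of_int u else 0)"
    unfolding sum_distrib_left sum_subtractf[symmetric]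
    by (intro sum.cong) (auto simp: f_def algebra_simps)
  also have "\<dots> = of_int w * complex_of_real n - of_int u"
    using pq(1) by (simp only: nsum) simp
  also have "\<dots> = 0" using w by (simp add: uw)
  finally have "(\<Sum>c<p * p ^ e. of_int (f c) * z ^ c) = 0" by (simp add: q_def)
  from prime_power_root_relation[OF p z1 z2 this]
  have rel: "f c = f (c mod q + d)" if "c < p * q" for c
    using that by (simp add: d_def q_def)
  have Nc: "N c = K (c mod q)" if "0 < c" "c < p * q" for c
    using rel[of c] that w d0 by (simp add: f_def K_def)
  have "w * int (N 0) - u = w * int (K 0)"
    using rel[of 0] pq d0 by (simp add: f_def K_def)
  then have "real_of_int (w * int (N 0) - u) = real_of_int (w * int (K 0))" by (rule arg_cong)
  then have n: "n = real (N 0) - real (K 0)"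
    using w by (simp add: uw field_simps)
  \<comment> \<open>Replacing \<open>N 0\<close> by \<open>K 0\<close> makes the sequence of counts
    periodic; the correction \<open>N 0 - K 0\<close> is \<open>n\<close>.\<close>
  have "int ((card E)\<^sup>2) = int (N 0) + (\<Sum>c\<in>{..<p * q} - {0}. int (N c))"
    using pq(1) by (simp add: csum sum.remove[of _ 0])
  also have "(\<Sum>c\<in>{..<p * q} - {0}. int (N c)) = (\<Sum>c\<in>{..<p * q} - {0}. int (K (c mod q)))"
    by (intro sum.cong) (use Nc in auto)
  also have "\<dots> = (\<Sum>c<p * q. int (K (c mod q))) - int (K 0)"
    using pq(1) by (simp add: sum.remove[of _ 0])
  also have "(\<Sum>c<p * q. int (K (c mod q))) = int p * (\<Sum>c<q. int (K c))"
    using sum_periodic[where h = "\<lambda>c. int (K c)" and z = 1 and p = p and q = q] by simp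
  finally have c2: "int ((card E)\<^sup>2) = int (N 0) - int (K 0) + int p * (\<Sum>c<q. int (K c))" by simp
  \<comment> \<open>Adding \<open>(p - 1) * n\<close> to the count turns its term \<open>n\<close>
    into \<open>p * n\<close>, so \<open>r\<close> is \<open>n\<close> plus the sum over
    \<open>K\<close>. That sum is at least \<open>K 0\<close>, whence
    \<open>r >= N 0\<close>.\<close>
  define r where "r = int (N 0) - int (K 0) + (\<Sum>c<q. int (K c))"
  have "int (K 0) \<le> (\<Sum>c<q. int (K c))" by (rule member_le_sum) (use q0 in auto)
  then have "int (card E) \<le> r" using N0 by (simp add: r_def)
  moreover have "real_of_int (int ((card E)\<^sup>2)) + (real p - 1) * n = real p * of_int r"
    unfolding c2 n r_def by (simp add: algebra_simps)
  ultimately show ?thesis by (auto simp: n_def)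
qed

section \<open>Characters of prime power order\<close>

text \<open>Multiplication by a primitive \<open>n\<close>-th root \<open>u\<close> permutes the
  roots and scales the sum by \<open>inverse (u ^ i)\<close>, which is not 1.\<close>

lemma sum_roots_unity_power_inverse:
  assumes "0 < i" "i < n"
  shows "(\<Sum>z | z ^ n = 1. inverse (z ^ i)) = (0::complex)"
proof -
  define R where "R = {z::complex. z ^ n = 1}"
  define u where "u = cis (2 * pi * real 1 / real n)"
  have n: "n > 0" "n > 1" using assms by auto
  have un: "u ^ n = 1" using n by (simp add: u_def DeMoivre)
  then have u0: "u \<noteq> 0" using n by (auto simp: power_0_left)
  have ui: "u ^ i \<noteq> 1"
  proof
    assume "u ^ i = 1"
    then have "cis (2 * pi * real i / real n) = cis (2 * pi * real 0 / real n)"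
      by (simp add: u_def DeMoivre mult_ac)
    moreover have "i \<in> {..<n}" "0 \<in> {..<n}" using assms by auto
    ultimately have "i = 0"
      using bij_betw_roots_unity[OF n(1)] unfolding bij_betw_def by (meson inj_onD)
    then show False using assms by simp
  qed
  have bij: "bij_betw (\<lambda>z. u * z) R R"
    by (rule bij_betw_byWitness[where f' = "\<lambda>z. z / u"])
      (use un u0 in \<open>auto simp: R_def power_mult_distrib power_divide\<close>)
  have "(\<Sum>z\<in>R. inverse (z ^ i)) = (\<Sum>z\<in>R. inverse ((u * z) ^ i))"
    by (rule sum.reindex_bij_betw[OF bij, symmetric])
  also have "\<dots> = inverse (u ^ i) * (\<Sum>z\<in>R. inverse (z ^ i))"
    by (simp add: power_mult_distrib sum_distrib_left)
  finally show ?thesis using ui by (auto simp: R_def inverse_eq_1_iff)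
qed

context comm_group
begin

section \<open>Fourier decomposition under translations\<close>

text \<open>For \<open>w ^ order G = 1\<close> this is, up to the factor \<open>order G\<close>, the
  projection of \<open>f\<close> onto the eigenspace of translation by \<open>t\<close> for the
  eigenvalue \<open>w\<close>.\<close>

definition spectral_part :: "'a \<Rightarrow> complex \<Rightarrow> ('a \<Rightarrow> complex) \<Rightarrow> 'a \<Rightarrow> complex" where
  "spectral_part t w f x = (\<Sum>i<order G. inverse (w ^ i) * f (t [^] i \<otimes> x))"

lemma spectral_part_shift:
  assumes fin: "finite (carrier G)" and t: "t \<in> carrier G" and x: "x \<in> carrier G"
    and w: "w ^ order G = 1"
  shows "spectral_part t w f (t \<otimes> x) = w * spectral_part t w f x"
proof -
  define F where "F i = inverse (w ^ i) * f (t [^] i \<otimes> x)" for i :: nat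
  have n: "order G > 0" using fin by (simp add: order_gt_0_iff_finite)
  then have w0: "w \<noteq> 0" using w by (auto simp: power_0_left)
  have "F (order G) = F 0" using t x w pow_order_eq_1[OF t] by (simp add: F_def)
  then have shift: "(\<Sum>i<order G. F (Suc i)) = (\<Sum>i<order G. F i)"
    using sum.lessThan_Suc_shift[of F "order G"] by (simp add: sum.lessThan_Suc)
  have "inverse (w ^ i) * f (t [^] i \<otimes> (t \<otimes> x)) = w * F (Suc i)" for i
  proof -
    have "t [^] i \<otimes> (t \<otimes> x) = t [^] Suc i \<otimes> x" using t x by (simp add: m_assoc)
    then show ?thesis using w0 by (simp add: F_def)
  qed
  then have "spectral_part t w f (t \<otimes> x) = w * (\<Sum>i<order G. F (Suc i))"
    by (simp add: spectral_part_def sum_distrib_left)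
  also have "\<dots> = w * spectral_part t w f x"
    unfolding shift by (simp add: spectral_part_def F_def)
  finally show ?thesis .
qed

text \<open>Translations by \<open>s\<close> and \<open>t\<close> commute, so projecting for
  \<open>t\<close> keeps an eigenvector for \<open>s\<close>.\<close>

lemma spectral_part_eigen:
  assumes "t \<in> carrier G" "s \<in> carrier G" "x \<in> carrier G"
    and "\<And>x. x \<in> carrier G \<Longrightarrow> f (s \<otimes> x) = c * f x"
  shows "spectral_part t w f (s \<otimes> x) = c * spectral_part t w f x"
proof -
  have "f (t [^] i \<otimes> (s \<otimes> x)) = c * f (t [^] i \<otimes> x)" for i :: nat
    using assms(4)[of "t [^] i \<otimes> x"] assms(1-3) by (simp add: m_lcomm)
  then show ?thesis by (simp add: spectral_part_def sum_distrib_left mult_ac)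
qed

text \<open>Fourier inversion: after swapping the sums, summation over the roots of unity kills
  every \<open>i\<close> except 0.\<close>

lemma sum_spectral_part:
  assumes fin: "finite (carrier G)" and t: "t \<in> carrier G" and x: "x \<in> carrier G"
  shows "(\<Sum>w | w ^ order G = 1. spectral_part t w f x) = of_nat (order G) * f x"
proof -
  have n: "order G > 0" using fin by (simp add: order_gt_0_iff_finite)
  have "(\<Sum>w | w ^ order G = 1. spectral_part t w f x)
      = (\<Sum>i<order G. (\<Sum>w | w ^ order G = 1. inverse (w ^ i)) * f (t [^] i \<otimes> x))"
    unfolding spectral_part_def by (subst sum.swap) (simp add: sum_distrib_right)
  also have "\<dots> = (\<Sum>i\<in>{0}. (\<Sum>w | w ^ order G = 1. inverse (w ^ i)) * f (t [^] i \<otimes> x))"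
    by (rule sum.mono_neutral_right) (use n sum_roots_unity_power_inverse in auto)
  also have "\<dots> = of_nat (order G) * f x"
    using t x n by (simp add: card_roots_unity_eq)
  finally show ?thesis .
qed

section \<open>Elementary properties of characters\<close>

lemma characters_mult:
  "\<lbrakk>\<chi> \<in> characters G; x \<in> carrier G; y \<in> carrier G\<rbrakk> \<Longrightarrow> \<chi> (x \<otimes> y) = \<chi> x * \<chi> y"
  by (simp add: characters_def complex_units_def hom_def)

lemma characters_nonzero: "\<lbrakk>\<chi> \<in> characters G; x \<in> carrier G\<rbrakk> \<Longrightarrow> \<chi> x \<noteq> 0"
  by (auto simp: characters_def complex_units_def hom_def)

lemma characters_one: "\<chi> \<in> characters G \<Longrightarrow> \<chi> \<one> = 1"
  using characters_mult[of \<chi> \<one> \<one>] characters_nonzero[of \<chi> \<one>] by simp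

lemma characters_pow:
  "\<lbrakk>\<chi> \<in> characters G; x \<in> carrier G\<rbrakk> \<Longrightarrow> \<chi> (x [^] (n::nat)) = \<chi> x ^ n"
  by (induction n) (simp_all add: characters_one characters_mult)

lemma characters_order:
  "\<lbrakk>\<chi> \<in> characters G; x \<in> carrier G\<rbrakk> \<Longrightarrow> \<chi> x ^ order G = 1"
  by (metis characters_pow characters_one pow_order_eq_1)

lemma norm_characters:
  assumes "finite (carrier G)" "\<chi> \<in> characters G" "x \<in> carrier G"
  shows "cmod (\<chi> x) = 1"
  using power_eq_imp_eq_norm[of "\<chi> x" "order G" 1] characters_order[OF assms(2,3)] assms(1)
  by (simp add: order_gt_0_iff_finite)

lemma characters_inv:
  assumes "finite (carrier G)" "\<chi> \<in> characters G" "x \<in> carrier G"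
  shows "\<chi> (inv x) = cnj (\<chi> x)"
proof -
  have "\<chi> (inv x) * \<chi> x = cnj (\<chi> x) * \<chi> x"
    using characters_mult[of \<chi> "inv x" x] characters_one[of \<chi>] norm_characters[OF assms] assms
      complex_norm_square[of "\<chi> x"] by (simp add: mult.commute)
  then show ?thesis using characters_nonzero[of \<chi> x] assms by simp
qed

lemma charactersI:
  assumes "\<And>x. x \<in> carrier G \<Longrightarrow> f x \<noteq> 0"
    and "\<And>x y. x \<in> carrier G \<Longrightarrow> y \<in> carrier G \<Longrightarrow> f (x \<otimes> y) = f x * f y"
  shows "restrict f (carrier G) \<in> characters G"
  using assms by (auto simp: characters_def complex_units_def hom_def)

text \<open>Translations commute, so a function can be cut down to a simultaneous eigenvector of all of them
  without changing an eigenvalue that is already there; such an eigenvector is a multiple of a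
  character.\<close>
lemma characters_separate:
  assumes fin: "finite (carrier G)" and g: "g \<in> carrier G" "g \<noteq> \<one>"
  shows "\<exists>\<chi>\<in>characters G. \<chi> g \<noteq> 1"
proof -
  define R where "R = {w::complex. w ^ order G = 1}"
  have n: "order G > 0" using fin by (simp add: order_gt_0_iff_finite)
  have finR: "finite R" unfolding R_def using n by (intro finite_roots_unity) auto
  \<comment> \<open>The indicator of \<open>\<one>\<close> is not invariant under translation by
    \<open>g\<close>, so it has a nonzero part for some eigenvalue \<open>w\<close> other than
    1.\<close>
  define f where "f x = (if x = \<one> then 1 else 0 :: complex)" for x
  have "\<exists>w\<in>R - {1}. \<exists>x\<in>carrier G. spectral_part g w f x \<noteq> 0"
  proof (rule ccontr)
    assume "\<not> ?thesis"
    then have z: "spectral_part g w f x = 0" if "w \<in> R - {1}" "x \<in> carrier G" for w x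
      using that by blast
    have 1: "of_nat (order G) * f x = spectral_part g 1 f x" if x: "x \<in> carrier G" for x
    proof -
      have "of_nat (order G) * f x = (\<Sum>w\<in>R. spectral_part g w f x)"
        using sum_spectral_part[OF fin g(1) x] by (simp add: R_def)
      also have "\<dots> = spectral_part g 1 f x + (\<Sum>w\<in>R - {1}. spectral_part g w f x)"
        by (rule sum.remove) (use finR in \<open>auto simp: R_def\<close>)
      finally show ?thesis using z x by simp
    qed
    have "of_nat (order G) * f (g \<otimes> \<one>) = of_nat (order G) * f \<one>"
      using 1[of "g \<otimes> \<one>"] 1[of \<one>] spectral_part_shift[OF fin g(1), of \<one> 1 f] g by simp
    then show False using g n by (simp add: f_def)
  qed
  then obtain w x0 where w: "w \<noteq> 1" "w ^ order G = 1" and x0: "x0 \<in> carrier G" "spectral_part g w f x0 \<noteq> 0"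
    by (auto simp: R_def)
  \<comment> \<open>Induction on the set of translations already diagonalized, keeping the
    eigenvalue \<open>w\<close> at \<open>g\<close>. Some part of \<open>h\<close> is nonzero
    because the parts add up to a nonzero multiple of \<open>h\<close>.\<close>
  have "\<exists>h. (\<exists>x\<in>carrier G. h x \<noteq> 0) \<and> (\<forall>x\<in>carrier G. h (g \<otimes> x) = w * h x) \<and>
      (\<forall>s\<in>S. \<exists>c. \<forall>x\<in>carrier G. h (s \<otimes> x) = c * h x)"
    if "finite S" "S \<subseteq> carrier G" for S
    using that
  proof (induction S)
    case empty
    then show ?case using x0 spectral_part_shift[OF fin g(1) _ w(2)] by (intro exI[of _ "spectral_part g w f"]) auto
  next
    case (insert t S)
    then obtain h x where h: "x \<in> carrier G" "h x \<noteq> 0" "\<forall>x\<in>carrier G. h (g \<otimes> x) = w * h x"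
        "\<forall>s\<in>S. \<exists>c. \<forall>x\<in>carrier G. h (s \<otimes> x) = c * h x"
      by auto
    have t: "t \<in> carrier G" using insert.prems by simp
    have "(\<Sum>w\<in>R. spectral_part t w h x) \<noteq> 0"
      using sum_spectral_part[OF fin t h(1), of h] h(2) n by (simp add: R_def)
    then obtain u where u: "u \<in> R" "spectral_part t u h x \<noteq> 0"
      by (meson sum.neutral)
    show ?case
    proof (intro exI[of _ "spectral_part t u h"] conjI ballI)
      show "\<exists>x\<in>carrier G. spectral_part t u h x \<noteq> 0" using u h(1) by blast
      show "spectral_part t u h (g \<otimes> x) = w * spectral_part t u h x" if "x \<in> carrier G" for x
        using spectral_part_eigen[OF t g(1) that] h(3) by blast
      show "\<exists>c. \<forall>x\<in>carrier G. spectral_part t u h (s \<otimes> x) = c * spectral_part t u h x"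
        if s: "s \<in> insert t S" for s
      proof (cases "s = t")
        case True
        then show ?thesis using spectral_part_shift[OF fin t] u(1) by (auto simp: R_def)
      next
        case False
        then obtain c where "\<forall>x\<in>carrier G. h (s \<otimes> x) = c * h x" using h(4) s by auto
        moreover have "s \<in> carrier G" using s insert.prems by auto
        ultimately show ?thesis using spectral_part_eigen[OF t, of s] by blast
      qed
    qed
  qed
  from this[OF fin subset_refl]
  obtain h x1 where h: "x1 \<in> carrier G" "h x1 \<noteq> 0" "\<forall>x\<in>carrier G. h (g \<otimes> x) = w * h x"
      "\<forall>s\<in>carrier G. \<exists>c. \<forall>x\<in>carrier G. h (s \<otimes> x) = c * h x"
    by blast
  from h(4) obtain c where c: "\<And>s x. s \<in> carrier G \<Longrightarrow> x \<in> carrier G \<Longrightarrow> h (s \<otimes> x) = c s * h x"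
    by metis
  \<comment> \<open>At \<open>\<one>\<close> the eigenvalue equation gives
    \<open>c s = h s / h \<one>\<close>; so \<open>h\<close>, which vanishes nowhere, becomes
    multiplicative after division by \<open>h \<one>\<close>.\<close>
  have c1: "h s = c s * h \<one>" if "s \<in> carrier G" for s
    using c[OF that one_closed] that by simp
  have h1: "h \<one> \<noteq> 0" using c1[OF h(1)] h(2) by auto
  have nz: "h s \<noteq> 0" if "s \<in> carrier G" for s
    using c[of "inv s" s] that h1 by auto
  have "restrict (\<lambda>x. h x / h \<one>) (carrier G) \<in> characters G"
  proof (rule charactersI)
    show "h x / h \<one> \<noteq> 0" if "x \<in> carrier G" for x using nz[OF that] h1 by simp
    show "h (x \<otimes> y) / h \<one> = h x / h \<one> * (h y / h \<one>)" if "x \<in> carrier G" "y \<in> carrier G" for x y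
      using c[OF that] c1[OF that(1)] h1 by simp
  qed
  moreover have "h (g \<otimes> \<one>) / h \<one> = w" using h(3) h1 by simp
  ultimately show ?thesis using w(1) g by (intro bexI) auto
qed

section \<open>Orthogonality for characters of bounded exponent\<close>

text \<open>With \<open>n\<close> the order of the Sylow subgroup, these characters of all of
  \<open>G\<close> stand in for the characters of that subgroup.\<close>

definition power_characters :: "nat \<Rightarrow> ('a \<Rightarrow> complex) set" where
  "power_characters n = {\<chi> \<in> characters G. \<forall>x\<in>carrier G. \<chi> x ^ n = 1}"

lemma finite_power_characters:
  assumes "finite (carrier G)" "n > 0"
  shows "finite (power_characters n)"
proof (rule finite_subset)
  show "power_characters n \<subseteq> PiE (carrier G) (\<lambda>_. {z. z ^ n = 1})"
    by (auto simp: power_characters_def characters_def PiE_iff extensional_def)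
  show "finite (PiE (carrier G) (\<lambda>_. {z::complex. z ^ n = 1}))"
    using assms by (intro finite_PiE finite_roots_unity) auto
qed

lemma principal_in_power_characters: "principal_character G \<in> power_characters n"
proof -
  have "principal_character G \<in> characters G"
    unfolding principal_character_def by (rule charactersI) auto
  then show ?thesis by (simp add: power_characters_def principal_character_def)
qed

lemma power_characters_restrict_mult:
  assumes "\<chi> \<in> power_characters n" "\<psi> \<in> power_characters n"
  shows "(\<lambda>x\<in>carrier G. \<chi> x * \<psi> x) \<in> power_characters n"
proof -
  have "(\<lambda>x\<in>carrier G. \<chi> x * \<psi> x) \<in> characters G"
    by (rule charactersI)
      (use assms in \<open>auto simp: power_characters_def characters_nonzero characters_mult\<close>)
  then show ?thesis using assms by (auto simp: power_characters_def power_mult_distrib)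
qed

text \<open>Pointwise multiplication by \<open>\<psi>\<close> permutes these characters and scales
  the sum by \<open>\<psi> g\<close>.\<close>

lemma sum_power_characters_eq_0:
  assumes fin: "finite (carrier G)" and n: "n > 0" and g: "g \<in> carrier G"
    and \<psi>: "\<psi> \<in> power_characters n" "\<psi> g \<noteq> 1"
  shows "(\<Sum>\<chi>\<in>power_characters n. \<chi> g) = 0"
proof -
  let ?X = "power_characters n"
  define m where "m \<chi> = (\<lambda>x\<in>carrier G. \<psi> x * \<chi> x)" for \<chi> :: "'a \<Rightarrow> complex"
  have into: "m ` ?X \<subseteq> ?X"
    using power_characters_restrict_mult[OF \<psi>(1)] by (auto simp: m_def)
  have inj: "inj_on m ?X"
  proof (rule inj_onI)
    fix \<chi> \<chi>' assume c: "\<chi> \<in> ?X" "\<chi>' \<in> ?X" and eq: "m \<chi> = m \<chi>'"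
    have "\<chi> x = \<chi>' x" if x: "x \<in> carrier G" for x
    proof -
      have "\<psi> x \<noteq> 0" using \<psi>(1) x by (auto simp: power_characters_def characters_nonzero)
      then show ?thesis using fun_cong[OF eq, of x] x by (simp add: m_def)
    qed
    then show "\<chi> = \<chi>'"
      using c by (intro extensionalityI[of _ "carrier G"]) (auto simp: power_characters_def characters_def)
  qed
  have bij: "bij_betw m ?X ?X"
    unfolding bij_betw_def using inj into endo_inj_surj[OF finite_power_characters[OF fin n]] by blast
  have "(\<Sum>\<chi>\<in>?X. \<chi> g) = (\<Sum>\<chi>\<in>?X. m \<chi> g)"
    by (rule sum.reindex_bij_betw[OF bij, symmetric])
  also have "\<dots> = \<psi> g * (\<Sum>\<chi>\<in>?X. \<chi> g)"
    using g by (simp add: m_def sum_distrib_left)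
  finally show ?thesis using \<psi>(2) by simp
qed

text \<open>The dual argument: translation by \<open>g\<close> permutes \<open>K\<close> and scales
  the sum by \<open>\<chi> g\<close>.\<close>

lemma sum_character_subgroup_eq_0:
  assumes "subgroup K G" "\<chi> \<in> characters G" "g \<in> K" "\<chi> g \<noteq> 1"
  shows "(\<Sum>x\<in>K. \<chi> x) = 0"
proof -
  interpret subgroup K G by fact
  have bij: "bij_betw (\<lambda>x. g \<otimes> x) K K"
    by (rule bij_betw_byWitness[where f' = "\<lambda>x. inv g \<otimes> x"])
      (use assms(3) in \<open>auto simp: m_assoc[symmetric]\<close>)
  have "(\<Sum>x\<in>K. \<chi> x) = (\<Sum>x\<in>K. \<chi> (g \<otimes> x))"
    by (rule sum.reindex_bij_betw[OF bij, symmetric])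
  also have "\<dots> = \<chi> g * (\<Sum>x\<in>K. \<chi> x)"
    using assms by (simp add: characters_mult sum_distrib_left)
  finally show ?thesis using assms(4) by simp
qed

lemma coprime_powers_eq_1:
  fixes z :: complex
  assumes "z ^ a = 1" "z ^ b = 1" "coprime a b"
  shows "z = 1"
proof (cases "a = 0")
  case True
  then show ?thesis using assms by simp
next
  case False
  then obtain x y where "a * x = b * y + gcd a b" using bezout_nat by blast
  then have "z ^ (a * x) = z ^ (b * y) * z" using assms(3) by simp
  then show ?thesis using assms(1,2) by (simp add: power_mult)
qed

text \<open>The coset of \<open>g\<close> lies in the quotient by \<open>K\<close>, a group of order
  \<open>w\<close>.\<close>

lemma subgroup_index_power_mem:
  assumes fin: "finite (carrier G)" and K: "subgroup K G" and ord: "order G = card K * w"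
    and g: "g \<in> carrier G"
  shows "g [^] w \<in> K"
proof -
  interpret K: normal K G using K by (rule subgroup_imp_normal)
  interpret Q: group "G Mod K" by (rule K.factorgroup_is_group)
  have "card K > 0" using fin K
    by (metis card_gt_0_iff finite_subset subgroup.subset subgroup.one_closed empty_iff)
  then have "order (G Mod K) = w"
    using lagrange[OF K] ord by (simp add: Coset.order_def FactGroup_def)
  moreover have "K #> g \<in> carrier (G Mod K)" using g by (auto simp: FactGroup_def RCOSETS_def)
  ultimately have "(K #> g) [^]\<^bsub>G Mod K\<^esub> w = K"
    using Q.pow_order_eq_1[of "K #> g"] by (simp add: FactGroup_def)
  moreover have "(K #> g) [^]\<^bsub>G Mod K\<^esub> w = K #> (g [^] w)"
    by (rule K.FactGroup_pow[OF g])
  ultimately show ?thesis using g K by (metis coset_join1 nat_pow_closed subgroup.subset)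
qed

text \<open>\<open>{x. x [^] w = \<one>}\<close> is the complement of the subgroup \<open>K\<close> (a Hall subgroup), and the characters
  of order dividing \<open>card K\<close> are those trivial on it.\<close>
lemma sum_power_characters:
  assumes fin: "finite (carrier G)" and K: "subgroup K G" and ord: "order G = card K * w"
    and cop: "coprime (card K) w" and g: "g \<in> carrier G"
  shows "(\<Sum>\<chi>\<in>power_characters (card K). \<chi> g) = of_nat (card K) * of_bool (g [^] w = \<one>)"
proof -
  let ?X = "power_characters (card K)"
  have K0: "card K > 0" using fin ord order_gt_0_iff_finite by (metis mult_0 neq0_conv)
  have X: "\<chi> \<in> characters G" "x \<in> carrier G \<Longrightarrow> \<chi> x ^ card K = 1" if "\<chi> \<in> ?X" for \<chi> x
    using that by (auto simp: power_characters_def)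
  have triv: "\<chi> x = 1" if "\<chi> \<in> ?X" "x \<in> carrier G" "\<chi> x ^ w = 1" for \<chi> x
    using coprime_powers_eq_1[OF X(2)[OF that(1,2)] that(3) cop] .
  \<comment> \<open>Orthogonality with the factor \<open>card ?X\<close>, which the double count
    below identifies with \<open>card K\<close>.\<close>
  have sum: "(\<Sum>\<chi>\<in>?X. \<chi> x) = of_nat (card ?X) * of_bool (x [^] w = \<one>)" if x: "x \<in> carrier G" for x
  proof (cases "x [^] w = \<one>")
    case True
    have "\<chi> x = 1" if "\<chi> \<in> ?X" for \<chi>
      using triv[OF that x] X(1)[OF that] True x by (metis characters_one characters_pow)
    then have "(\<Sum>\<chi>\<in>?X. \<chi> x) = (\<Sum>\<chi>\<in>?X. 1)" by (rule sum.cong[OF refl])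
    then show ?thesis using True by simp
  next
    case False
    then obtain \<psi> where \<psi>: "\<psi> \<in> characters G" "\<psi> (x [^] w) \<noteq> 1"
      using characters_separate[OF fin, of "x [^] w"] x by auto
    \<comment> \<open>The \<open>w\<close>-th power of a separating character has exponent
      \<open>card K\<close>, since \<open>order G = card K * w\<close>, and its value at
      \<open>x\<close> is \<open>\<psi> (x [^] w)\<close>.\<close>
    define \<chi> where "\<chi> = (\<lambda>y\<in>carrier G. \<psi> y ^ w)"
    have "\<chi> \<in> characters G" unfolding \<chi>_def
      by (rule charactersI) (use \<psi>(1) in \<open>auto simp: characters_nonzero characters_mult power_mult_distrib\<close>)
    moreover have "\<chi> y ^ card K = 1" if "y \<in> carrier G" for y
    proof -
      have "\<chi> y ^ card K = \<psi> y ^ order G"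
        using that ord by (simp add: \<chi>_def mult.commute flip: power_mult)
      then show ?thesis using characters_order[OF \<psi>(1) that] by simp
    qed
    ultimately have "\<chi> \<in> ?X" by (simp add: power_characters_def)
    moreover have "\<chi> x \<noteq> 1" using \<psi> x by (simp add: \<chi>_def characters_pow)
    ultimately show ?thesis
      using sum_power_characters_eq_0[OF fin K0 x] False by simp
  qed
  have sub: "K \<subseteq> carrier G" by (rule subgroup.subset[OF K])
  have finK: "finite K" using sub fin finite_subset by blast
  \<comment> \<open>Either order of summation over \<open>?X\<close> and \<open>K\<close> isolates
    one term: the principal character here, giving \<open>card K\<close>, and
    \<open>x = \<one>\<close> after the swap, giving \<open>card ?X\<close>.\<close>
  have "(\<Sum>\<chi>\<in>?X. \<Sum>x\<in>K. \<chi> x) = (\<Sum>\<chi>\<in>?X. of_nat (card K) * of_bool (\<chi> = principal_character G))"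
  proof (rule sum.cong[OF refl])
    fix \<chi> assume \<chi>: "\<chi> \<in> ?X"
    show "(\<Sum>x\<in>K. \<chi> x) = of_nat (card K) * of_bool (\<chi> = principal_character G)"
    proof (cases "\<forall>x\<in>K. \<chi> x = 1")
      case True
      have "\<chi> x = 1" if x: "x \<in> carrier G" for x
      proof -
        have "\<chi> x ^ w = \<chi> (x [^] w)" using X(1)[OF \<chi>] x by (simp add: characters_pow)
        also have "\<dots> = 1" using True subgroup_index_power_mem[OF fin K ord x] by blast
        finally show ?thesis by (rule triv[OF \<chi> x])
      qed
      then have "\<chi> = principal_character G"
        using X(1)[OF \<chi>] unfolding principal_character_def
        by (intro extensionalityI[of _ "carrier G"]) (auto simp: characters_def)
      then show ?thesis using True by simp
    next
      case False
      then have "\<chi> \<noteq> principal_character G" using sub by (auto simp: principal_character_def)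
      then show ?thesis
        using False sum_character_subgroup_eq_0[OF K X(1)[OF \<chi>]] by auto
    qed
  qed
  also have "\<dots> = of_nat (card K)"
    using finite_power_characters[OF fin K0] principal_in_power_characters
    by (simp add: sum_distrib_left[symmetric] of_bool_def sum.delta)
  also have "(\<Sum>\<chi>\<in>?X. \<Sum>x\<in>K. \<chi> x) = (\<Sum>x\<in>K. of_nat (card ?X) * of_bool (x [^] w = \<one>))"
    using sum sub by (subst sum.swap) (auto intro!: sum.cong)
  also have "\<dots> = (\<Sum>x\<in>K. of_nat (card ?X) * of_bool (x = \<one>))"
  proof (rule sum.cong[OF refl])
    fix x assume x: "x \<in> K"
    have "x = \<one>" if "x [^] w = \<one>"
    proof -
      have xc: "x \<in> carrier G" using x sub by auto
      interpret KG: group "G\<lparr>carrier := K\<rparr>" using K by (rule subgroup.subgroup_is_group) (rule group_axioms)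
      have "x [^] card K = \<one>"
        using KG.pow_order_eq_1[of x] x by (simp add: Coset.order_def flip: nat_pow_consistent)
      then have "ord x dvd card K" "ord x dvd w"
        using that xc by (simp_all add: pow_eq_id)
      then have "ord x = 1" using coprime_common_divisor[OF cop] by simp
      then show ?thesis using ord_eq_1[OF xc] by simp
    qed
    then show "of_nat (card ?X) * of_bool (x [^] w = \<one>) = of_nat (card ?X) * (of_bool (x = \<one>) :: complex)"
      by auto
  qed
  also have "\<dots> = of_nat (card ?X)"
    using finK subgroup.one_closed[OF K] by (simp add: sum_distrib_left[symmetric] of_bool_def sum.delta)
  finally have "card ?X = card K" by (simp only: of_nat_eq_iff)
  then show ?thesis using sum[OF g] by simp
qed

text \<open>In the sum of the values on \<open>E\<close> over all these characters only the
  principal one remains, giving \<open>card E\<close>; by orthogonality the same sum is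
  \<open>card K\<close> times the number of elements of \<open>E\<close> in the complement of
  \<open>K\<close>.\<close>

lemma card_dvd_of_power_characters_vanish:
  assumes fin: "finite (carrier G)" and K: "subgroup K G" and ord: "order G = card K * w"
    and cop: "coprime (card K) w" and E: "E \<subseteq> carrier G"
    and van: "\<And>\<chi>. \<chi> \<in> power_characters (card K) \<Longrightarrow> \<chi> \<noteq> principal_character G \<Longrightarrow> (\<Sum>x\<in>E. \<chi> x) = 0"
  shows "card K dvd card E"
proof -
  let ?X = "power_characters (card K)"
  have K0: "card K > 0" using fin ord order_gt_0_iff_finite by (metis mult_0 neq0_conv)
  have "(\<Sum>\<chi>\<in>?X. \<Sum>x\<in>E. \<chi> x) = (\<Sum>\<chi>\<in>{principal_character G}. \<Sum>x\<in>E. \<chi> x)"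
    by (rule sum.mono_neutral_right)
      (use van principal_in_power_characters finite_power_characters[OF fin K0] in auto)
  also have "\<dots> = of_nat (card E)"
    using E by (simp add: principal_character_def subset_iff)
  also have "(\<Sum>\<chi>\<in>?X. \<Sum>x\<in>E. \<chi> x) = (\<Sum>x\<in>E. of_nat (card K) * of_bool (x [^] w = \<one>))"
    using sum_power_characters[OF fin K ord cop] E by (subst sum.swap) (auto intro!: sum.cong)
  also have "\<dots> = of_nat (card K * (\<Sum>x\<in>E. of_bool (x [^] w = \<one>)))"
    by (simp add: sum_distrib_left)
  finally have "card K * (\<Sum>x\<in>E. of_bool (x [^] w = \<one>)) = card E" by (simp only: of_nat_eq_iff)
  then show ?thesis by (metis dvd_triv_left)
qed

text \<open>Parseval: the squared norms add up to \<open>card K\<close> times the number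
  \<open>r\<close> of pairs in \<open>E\<close> whose quotient lies in the complement of
  \<open>K\<close>. The diagonal pairs give the lower bound.\<close>

lemma power_characters_constant_norm:
  assumes fin: "finite (carrier G)" and K: "subgroup K G" and ord: "order G = card K * w"
    and cop: "coprime (card K) w" and E: "E \<subseteq> carrier G"
    and norm: "\<And>\<chi>. \<chi> \<in> power_characters (card K) \<Longrightarrow> \<chi> \<noteq> principal_character G \<Longrightarrow>
      (cmod (\<Sum>x\<in>E. \<chi> x))\<^sup>2 = of_int l"
  shows "\<exists>r::int. r \<ge> int (card E) \<and>
    (int (card E))\<^sup>2 + (int (card K) - 1) * l = int (card K) * r"
proof -
  let ?X = "power_characters (card K)"
  have K0: "card K > 0" using fin ord order_gt_0_iff_finite by (metis mult_0 neq0_conv)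
  have finE: "finite E" using E fin finite_subset by blast
  have finX: "finite ?X" by (rule finite_power_characters[OF fin K0])
  have P: "principal_character G \<in> ?X" by (rule principal_in_power_characters)
  \<comment> \<open>Evaluating orthogonality at \<open>\<one>\<close> counts the characters.\<close>
  have "of_nat (card ?X) = of_nat (card K) * (of_bool (\<one> [^] w = \<one>) :: complex)"
    using sum_power_characters[OF fin K ord cop one_closed]
    using sum.cong[of ?X ?X "\<lambda>\<chi>. \<chi> \<one>" "\<lambda>_. 1"] by (simp add: power_characters_def characters_one)
  then have "complex_of_nat (card ?X) = of_nat (card K)" by simp
  then have cX: "card ?X = card K" by (simp only: of_nat_eq_iff)
  define r where "r = (\<Sum>(x, y)\<in>E \<times> E. of_bool ((x \<otimes> inv y) [^] w = \<one>) :: int)"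
  have "complex_of_real (\<Sum>\<chi>\<in>?X. (cmod (\<Sum>x\<in>E. \<chi> x))\<^sup>2) = (\<Sum>\<chi>\<in>?X. \<Sum>(x, y)\<in>E \<times> E. \<chi> (x \<otimes> inv y))"
  proof -
    have "complex_of_real ((cmod (\<Sum>x\<in>E. \<chi> x))\<^sup>2) = (\<Sum>(x, y)\<in>E \<times> E. \<chi> (x \<otimes> inv y))"
      if "\<chi> \<in> ?X" for \<chi>
    proof -
      have \<chi>: "\<chi> \<in> characters G" using that by (simp add: power_characters_def)
      have "complex_of_real ((cmod (\<Sum>x\<in>E. \<chi> x))\<^sup>2) = (\<Sum>(x, y)\<in>E \<times> E. \<chi> x * cnj (\<chi> y))"
        by (simp only: complex_norm_square cnj_sum sum_product sum.cartesian_product)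
      also have "\<dots> = (\<Sum>(x, y)\<in>E \<times> E. \<chi> (x \<otimes> inv y))"
        using E \<chi> by (intro sum.cong) (auto simp: characters_mult characters_inv[OF fin] subset_iff)
      finally show ?thesis .
    qed
    then show ?thesis by (simp only: of_real_sum cong: sum.cong)
  qed
  also have "\<dots> = (\<Sum>(x, y)\<in>E \<times> E. of_nat (card K) * of_bool ((x \<otimes> inv y) [^] w = \<one>))"
    using E sum_power_characters[OF fin K ord cop]
    by (subst sum.swap) (auto intro!: sum.cong simp: subset_iff case_prod_beta)
  also have "\<dots> = complex_of_real (of_int (int (card K) * r))"
    by (simp only: of_real_of_int_eq) (simp add: r_def sum_distrib_left case_prod_beta)
  finally have sum: "(\<Sum>\<chi>\<in>?X. (cmod (\<Sum>x\<in>E. \<chi> x))\<^sup>2) = of_int (int (card K) * r)"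
    by (simp only: of_real_eq_iff)
  have "(\<Sum>\<chi>\<in>?X. (cmod (\<Sum>x\<in>E. \<chi> x))\<^sup>2)
      = (cmod (\<Sum>x\<in>E. principal_character G x))\<^sup>2 + (\<Sum>\<chi>\<in>?X - {principal_character G}. (cmod (\<Sum>x\<in>E. \<chi> x))\<^sup>2)"
    by (rule sum.remove[OF finX P])
  also have "(\<Sum>x\<in>E. principal_character G x) = of_nat (card E)"
    using E by (simp add: principal_character_def subset_iff)
  also have "(\<Sum>\<chi>\<in>?X - {principal_character G}. (cmod (\<Sum>x\<in>E. \<chi> x))\<^sup>2) = of_int ((int (card K) - 1) * l)"
  proof -
    have c: "real (card (?X - {principal_character G})) = real (card K) - 1"
      using finX P cX K0 by (simp add: of_nat_diff)
    have "(\<Sum>\<chi>\<in>?X - {principal_character G}. (cmod (\<Sum>x\<in>E. \<chi> x))\<^sup>2)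
        = (\<Sum>\<chi>\<in>?X - {principal_character G}. of_int l)"
      by (rule sum.cong) (use norm in auto)
    also have "\<dots> = of_int ((int (card K) - 1) * l)" by (simp only: sum_constant c) simp
    finally show ?thesis .
  qed
  finally have "real_of_int ((int (card E))\<^sup>2 + (int (card K) - 1) * l) = of_int (int (card K) * r)"
    unfolding sum by simp
  then have eq: "(int (card E))\<^sup>2 + (int (card K) - 1) * l = int (card K) * r" by (simp only: of_int_eq_iff)
  have "int (card E) = (\<Sum>(x, y)\<in>(\<lambda>x. (x, x)) ` E. of_bool ((x \<otimes> inv y) [^] w = \<one>))"
    using E by (subst sum.reindex) (auto simp: inj_on_def subset_iff)
  also have "\<dots> \<le> r" unfolding r_def
    by (rule sum_mono2) (use finE in auto)
  finally show ?thesis using eq by blast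
qed

end

section \<open>Character values of an SEDF\<close>

lemma (in comm_group) char_ext_gr_mult:
  assumes fin: "finite (carrier G)" and \<chi>: "\<chi> \<in> characters G"
  shows "char_ext G \<chi> (gr_mult G f h) = char_ext G \<chi> f * char_ext G \<chi> h"
proof -
  have translate: "(\<Sum>g\<in>carrier G. of_int (h (inv x \<otimes> g)) * \<chi> g) = \<chi> x * char_ext G \<chi> h"
    if x: "x \<in> carrier G" for x
  proof -
    have bij: "bij_betw (\<lambda>g. x \<otimes> g) (carrier G) (carrier G)"
      by (rule bij_betw_byWitness[where f' = "\<lambda>g. inv x \<otimes> g"])
        (use x in \<open>auto simp: m_assoc[symmetric]\<close>)
    have "(\<Sum>g\<in>carrier G. of_int (h (inv x \<otimes> g)) * \<chi> g)
        = (\<Sum>g\<in>carrier G. of_int (h (inv x \<otimes> (x \<otimes> g))) * \<chi> (x \<otimes> g))"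
      by (rule sum.reindex_bij_betw[OF bij, symmetric])
    also have "\<dots> = (\<Sum>g\<in>carrier G. \<chi> x * (of_int (h g) * \<chi> g))"
      using x \<chi> by (intro sum.cong) (auto simp: m_assoc[symmetric] characters_mult)
    finally show ?thesis by (simp add: char_ext_def sum_distrib_left)
  qed
  have "char_ext G \<chi> (gr_mult G f h)
      = (\<Sum>x\<in>carrier G. of_int (f x) * (\<Sum>g\<in>carrier G. of_int (h (inv x \<otimes> g)) * \<chi> g))"
    unfolding char_ext_def gr_mult_def
    by (simp add: sum_distrib_left sum_distrib_right mult.assoc) (rule sum.swap)
  also have "\<dots> = (\<Sum>x\<in>carrier G. of_int (f x) * \<chi> x) * char_ext G \<chi> h"
    by (simp add: translate sum_distrib_right mult.assoc)
  finally show ?thesis by (simp add: char_ext_def)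
qed

lemma char_ext_gr_of_set:
  assumes "finite (carrier G)" "A \<subseteq> carrier G"
  shows "char_ext G \<chi> (gr_of_set A) = (\<Sum>x\<in>A. \<chi> x)"
proof -
  have "char_ext G \<chi> (gr_of_set A) = (\<Sum>x\<in>carrier G. if x \<in> A then \<chi> x else 0)"
    unfolding char_ext_def gr_of_set_def by (intro sum.cong) auto
  also have "\<dots> = (\<Sum>x\<in>carrier G \<inter> A. \<chi> x)" using assms by (simp add: sum.inter_restrict)
  also have "carrier G \<inter> A = A" using assms by blast
  finally show ?thesis .
qed

lemma (in comm_group) char_ext_gr_of_set_inv:
  assumes fin: "finite (carrier G)" and \<chi>: "\<chi> \<in> characters G" and A: "A \<subseteq> carrier G"
  shows "char_ext G \<chi> (gr_of_set_inv G A) = cnj (\<Sum>x\<in>A. \<chi> x)"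
proof -
  have "char_ext G \<chi> (gr_of_set_inv G A) = (\<Sum>a\<in>A. \<Sum>g\<in>carrier G. of_bool (g = inv a) * \<chi> g)"
    unfolding char_ext_def gr_of_set_inv_def
    by (simp add: sum_distrib_right) (rule sum.swap)
  also have "\<dots> = (\<Sum>a\<in>A. cnj (\<chi> a))"
  proof (rule sum.cong[OF refl])
    fix a assume "a \<in> A"
    then have a: "a \<in> carrier G" using A by blast
    have "(\<Sum>g\<in>carrier G. of_bool (g = inv a) * \<chi> g) = (\<Sum>g\<in>carrier G. if g = inv a then \<chi> g else 0)"
      by (intro sum.cong) auto
    also have "\<dots> = cnj (\<chi> a)" using a fin characters_inv[OF fin \<chi> a] by simp
    finally show "(\<Sum>g\<in>carrier G. of_bool (g = inv a) * \<chi> g) = cnj (\<chi> a)" .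
  qed
  finally show ?thesis by simp
qed

text \<open>Under \<open>\<chi>\<close> inverses become complex conjugates; on the right the whole
  group contributes 0, as \<open>\<chi>\<close> is nonprincipal, and the identity element
  contributes 1.\<close>

lemma (in comm_group) SEDF_character_equation:
  assumes fin: "finite (carrier G)" and S: "SEDF G v m k lam D"
    and \<chi>: "\<chi> \<in> characters G" "\<chi> \<noteq> principal_character G" and j: "j \<in> {1..m}"
  shows "(\<Sum>x\<in>D j. \<chi> x) * cnj (\<Sum>i\<in>{1..m} - {j}. \<Sum>x\<in>D i. \<chi> x) = - of_nat lam"
proof -
  have sub: "D i \<subseteq> carrier G" if "i \<in> {1..m}" for i using S that by (simp add: SEDF_def)
  let ?h = "\<lambda>h. \<Sum>i\<in>{1..m} - {j}. gr_of_set_inv G (D i) h"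
  have "\<exists>x\<in>carrier G. \<chi> x \<noteq> 1"
  proof (rule ccontr)
    assume "\<not> ?thesis"
    then have "\<chi> = principal_character G" using \<chi>(1) unfolding principal_character_def
      by (intro extensionalityI[of _ "carrier G"]) (auto simp: characters_def)
    then show False using \<chi>(2) by blast
  qed
  then have sum0: "(\<Sum>x\<in>carrier G. \<chi> x) = 0"
    using sum_character_subgroup_eq_0[OF subgroup_self \<chi>(1)] by blast
  have "char_ext G \<chi> ?h = (\<Sum>i\<in>{1..m} - {j}. char_ext G \<chi> (gr_of_set_inv G (D i)))"
    unfolding char_ext_def by (simp add: sum_distrib_right) (rule sum.swap)
  also have "\<dots> = cnj (\<Sum>i\<in>{1..m} - {j}. \<Sum>x\<in>D i. \<chi> x)"
    using char_ext_gr_of_set_inv[OF fin \<chi>(1) sub] by simp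
  finally have prod: "char_ext G \<chi> (gr_mult G (gr_of_set (D j)) ?h)
      = (\<Sum>x\<in>D j. \<chi> x) * cnj (\<Sum>i\<in>{1..m} - {j}. \<Sum>x\<in>D i. \<chi> x)"
    by (simp add: char_ext_gr_mult[OF fin \<chi>(1)] char_ext_gr_of_set[OF fin sub[OF j]])
  have coeff: "gr_mult G (gr_of_set (D j)) ?h g = int lam * (gr_of_set (carrier G) g - gr_of_set {\<one>} g)"
    if "g \<in> carrier G" for g
    using S j that unfolding SEDF_def by blast
  have "char_ext G \<chi> (gr_mult G (gr_of_set (D j)) ?h)
      = (\<Sum>g\<in>carrier G. of_nat lam * (of_int (gr_of_set (carrier G) g) * \<chi> g - of_int (gr_of_set {\<one>} g) * \<chi> g))"
    unfolding char_ext_def by (intro sum.cong refl, subst coeff) (simp_all add: algebra_simps)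
  also have "\<dots> = of_nat lam * (char_ext G \<chi> (gr_of_set (carrier G)) - char_ext G \<chi> (gr_of_set {\<one>}))"
    unfolding char_ext_def sum_subtractf[symmetric] by (simp add: sum_distrib_left)
  finally show ?thesis
    using prod characters_one[OF \<chi>(1)] sum0 by (simp add: char_ext_gr_of_set fin)
qed

text \<open>Uniqueness of lowest terms, which settles the \<open>THE\<close> in
  \<open>char_pair\<close>.\<close>

lemma rational_coprime_unique:
  fixes a b a' b' :: int
  assumes "a > 0" "a' > 0" "coprime a b" "coprime a' b'" "real_of_int b / a = real_of_int b' / a'"
  shows "a = a' \<and> b = b'"
proof -
  have "real_of_int (b * a') = real_of_int (b' * a)" using assms by (simp add: field_simps)
  then have eq: "b * a' = b' * a" by (simp only: of_int_eq_iff)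
  then have "a dvd a'" "a' dvd a"
    using assms(3,4) by (metis coprime_dvd_mult_right_iff dvd_triv_right)+
  then have "a = a'" using assms(1,2) by (simp add: zdvd_antisym_nonneg)
  then show ?thesis using eq assms(1) by simp
qed

text \<open>Each \<open>s j / (\<Sum>i. s i)\<close> is a root \<open>(1 \<plusminus> \<sigma>) / 2\<close> of one real quadratic, and these numbers sum to \<open>1\<close>;
  for \<open>m > 2\<close> this makes \<open>\<sigma>\<close> rational and forces both signs to occur.\<close>
lemma character_values_quadratic:
  fixes s :: "nat \<Rightarrow> complex" and m lam :: nat
  defines "S \<equiv> (\<Sum>i\<in>{1..m}. s i)"
  assumes m: "m > 2" and lam: "lam > 0" and S0: "S \<noteq> 0"
    and eq: "\<And>j. j \<in> {1..m} \<Longrightarrow> s j * cnj (S - s j) = - of_nat lam"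
  defines "\<sigma> \<equiv> sqrt (1 + 4 * real lam / (cmod S)\<^sup>2)"
  shows "\<sigma> \<in> \<rat>" "\<sigma> > 1" "(cmod S)\<^sup>2 = 4 * real lam / (\<sigma>\<^sup>2 - 1)"
    and "\<exists>j\<in>{1..m}. (cmod (s j))\<^sup>2 = real lam * (\<sigma> - 1) / (\<sigma> + 1)"
    and "\<exists>j\<in>{1..m}. (cmod (s j))\<^sup>2 = real lam * (\<sigma> + 1) / (\<sigma> - 1)"
proof -
  define n where "n = (cmod S)\<^sup>2"
  have n0: "n > 0" using S0 by (simp add: n_def)
  have \<sigma>2: "\<sigma>\<^sup>2 = 1 + 4 * real lam / n" using n0 by (simp add: \<sigma>_def n_def)
  show \<sigma>1: "\<sigma> > 1" using n0 lam by (simp add: \<sigma>_def n_def)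
  have n: "n = 4 * real lam / (\<sigma>\<^sup>2 - 1)" using n0 lam unfolding \<sigma>2 by simp
  then show "(cmod S)\<^sup>2 = 4 * real lam / (\<sigma>\<^sup>2 - 1)" by (simp add: n_def)
  \<comment> \<open>\<open>s j * cnj S\<close> is the real number \<open>|s j|^2 - lam\<close>, so
    \<open>s j\<close> is a real multiple of \<open>S\<close>, with factor
    \<open>\<alpha> j\<close>.\<close>
  define \<alpha> where "\<alpha> j = ((cmod (s j))\<^sup>2 - real lam) / n" for j
  have s: "s j = of_real (\<alpha> j) * S" if "j \<in> {1..m}" for j
  proof -
    have "s j * cnj S = of_real ((cmod (s j))\<^sup>2 - real lam)"
      using eq[OF that] complex_norm_square[of "s j"] by (simp add: algebra_simps)
    then have "s j * (S * cnj S) = of_real ((cmod (s j))\<^sup>2 - real lam) * S"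
      by (metis mult.assoc mult.commute)
    moreover have "S * cnj S = of_real n" unfolding n_def by (simp only: complex_norm_square)
    ultimately show ?thesis using n0 by (simp add: \<alpha>_def field_simps)
  qed
  have norm: "(cmod (s j))\<^sup>2 = (\<alpha> j)\<^sup>2 * n" if "j \<in> {1..m}" for j
    by (simp add: s[OF that] norm_mult power_mult_distrib n_def)
  \<comment> \<open>Comparing \<open>|s j|^2 = (\<alpha> j)^2 * n\<close> with the definition of
    \<open>\<alpha>\<close> yields the quadratic \<open>x^2 - x = lam / n\<close>, of discriminant
    \<open>\<sigma>^2\<close>.\<close>
  have val: "\<alpha> j = (1 + \<sigma>) / 2 \<or> \<alpha> j = (1 - \<sigma>) / 2" if "j \<in> {1..m}" for j
  proof -
    have "\<alpha> j * n = (\<alpha> j)\<^sup>2 * n - real lam" using norm[OF that] n0 by (simp add: \<alpha>_def)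
    then have "(2 * \<alpha> j - 1)\<^sup>2 = \<sigma>\<^sup>2" unfolding \<sigma>2 using n0
      by (simp add: field_simps power2_eq_square)
    then have "2 * \<alpha> j - 1 = \<sigma> \<or> 2 * \<alpha> j - 1 = - \<sigma>" by (simp only: power2_eq_iff)
    then show ?thesis by auto
  qed
  have "of_real (\<Sum>j\<in>{1..m}. \<alpha> j) * S = 1 * S"
    unfolding of_real_sum sum_distrib_right using s by (simp add: S_def)
  then have sum1: "(\<Sum>j\<in>{1..m}. \<alpha> j) = 1"
    using S0 by (metis mult_right_cancel of_real_1 of_real_eq_iff)
  \<comment> \<open>\<open>c\<close> counts the plus signs. That the \<open>\<alpha> j\<close> sum
    to 1 becomes the linear equation \<open>key\<close> for \<open>\<sigma>\<close>, whose right
    side is nonzero by \<open>m > 2\<close>.\<close>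
  define P where "P = {j\<in>{1..m}. \<alpha> j = (1 + \<sigma>) / 2}"
  define c where "c = card P"
  have Pm: "P \<subseteq> {1..m}" by (auto simp: P_def)
  have cm: "c \<le> m" unfolding c_def using card_mono[OF _ Pm] by simp
  have "1 = (\<Sum>j\<in>P. \<alpha> j) + (\<Sum>j\<in>{1..m} - P. \<alpha> j)"
    using sum1 sum.subset_diff[OF Pm, of \<alpha>] by simp
  also have "(\<Sum>j\<in>P. \<alpha> j) = (\<Sum>j\<in>P. (1 + \<sigma>) / 2)" by (rule sum.cong) (auto simp: P_def)
  also have "(\<Sum>j\<in>{1..m} - P. \<alpha> j) = (\<Sum>j\<in>{1..m} - P. (1 - \<sigma>) / 2)"
    by (rule sum.cong[OF refl]) (use val in \<open>auto simp: P_def\<close>)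
  also have "card ({1..m} - P) = m - c" using Pm by (simp add: card_Diff_subset finite_subset c_def)
  then have "(\<Sum>j\<in>{1..m} - P. (1 - \<sigma>) / 2) = real (m - c) * ((1 - \<sigma>) / 2)" by simp
  finally have key: "\<sigma> * (real m - 2 * real c) = real m - 2"
    using cm by (simp add: c_def[symmetric] of_nat_diff field_simps)
  have mc: "real m - 2 * real c \<noteq> 0" using key m by auto
  then have "\<sigma> = (real m - 2) / (real m - 2 * real c)" using key by (simp add: field_simps)
  then show "\<sigma> \<in> \<rat>" by simp
  \<comment> \<open>Equal signs throughout would give \<open>\<sigma> = (m - 2) / m\<close> or its
    negative, contrary to \<open>\<sigma> > 1\<close>.\<close>
  have c0: "c \<noteq> 0"
  proof
    assume "c = 0"
    then have "\<sigma> * real m = real m - 2" using key by simp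
    moreover have "\<sigma> * real m > 1 * real m" using \<sigma>1 m by (intro mult_strict_right_mono) auto
    ultimately show False by simp
  qed
  have c1: "c \<noteq> m"
  proof
    assume "c = m"
    then have "\<sigma> * real m = 2 - real m" using key by (simp add: algebra_simps)
    moreover have "\<sigma> * real m > 0" using \<sigma>1 m by auto
    ultimately show False using m by simp
  qed
  have nn: "n = 4 * real lam / ((\<sigma> - 1) * (\<sigma> + 1))"
    unfolding n by (simp add: algebra_simps power2_eq_square)
  have pos: "(cmod (s j))\<^sup>2 = real lam * (\<sigma> + 1) / (\<sigma> - 1)"
    if "j \<in> {1..m}" "\<alpha> j = (1 + \<sigma>) / 2" for j
    unfolding norm[OF that(1)] that(2) nn using \<sigma>1 by (simp add: divide_simps power2_eq_square add.commute)
  have neg: "(cmod (s j))\<^sup>2 = real lam * (\<sigma> - 1) / (\<sigma> + 1)"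
    if "j \<in> {1..m}" "\<alpha> j = (1 - \<sigma>) / 2" for j
    unfolding norm[OF that(1)] that(2) nn using \<sigma>1
    by (simp add: divide_simps power2_eq_square) (simp add: algebra_simps)
  have "P \<noteq> {}" using c0 by (auto simp: c_def)
  then show "\<exists>j\<in>{1..m}. (cmod (s j))\<^sup>2 = real lam * (\<sigma> + 1) / (\<sigma> - 1)"
    using pos unfolding P_def by blast
  have "P \<noteq> {1..m}" using c1 by (auto simp: c_def)
  then obtain j where "j \<in> {1..m}" "j \<notin> P" using Pm by blast
  then show "\<exists>j\<in>{1..m}. (cmod (s j))\<^sup>2 = real lam * (\<sigma> - 1) / (\<sigma> + 1)"
    using neg[of j] val[of j] by (auto simp: P_def)
qed

section \<open>The two alternatives for a nontrivial SEDF\<close>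

theorem theorem5p12:
  fixes G :: "('a, 'b) monoid_scheme" (structure)
    and v m k lam p t :: nat
    and D :: "nat \<Rightarrow> 'a set"
    and Gp :: "'a set"
    and a b :: "nat \<Rightarrow> int"
  assumes "comm_group G" and "finite (carrier G)"
    and "SEDF G v m k lam D" and "k > 1" and "m > 2"
    and "prime p" and "p dvd v" and "sylow_subgroup G p Gp"
    and "\<And>i. i \<in> {1..t} \<Longrightarrow> b i > a i \<and> a i > 0 \<and> gcd (a i) (b i) = 1"
    and "\<And>\<chi>. \<chi> \<in> nonvanishing_characters G (\<Union>i\<in>{1..m}. D i) \<Longrightarrow>
           char_pair G lam (\<Union>i\<in>{1..m}. D i) \<chi> \<in> {(a i, b i) | i. i \<in> {1..t}}"
  shows "(card Gp dvd k * m \<and>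
          (\<exists>r1::int. r1 \<ge> int k \<and>
             (int k)\<^sup>2 + (int (card Gp) - 1) * int lam = int (card Gp) * r1))
       \<or> (\<exists>i\<in>{1..t}.
          (\<exists>r2::int. r2 \<ge> int (k * m) \<and>
             (real k)\<^sup>2 * (real m)\<^sup>2
               + (real p - 1) * (4 * (real_of_int (a i))\<^sup>2 * real lam
                   / ((real_of_int (b i))\<^sup>2 - (real_of_int (a i))\<^sup>2))
             = real p * real_of_int r2) \<and>
          (\<exists>r3::int. r3 \<ge> int k \<and>
             (real k)\<^sup>2
               + (real p - 1) * (real_of_int (b i - a i) * real lam / real_of_int (b i + a i))
             = real p * real_of_int r3) \<and>
          (\<exists>r4::int.
             (real k)\<^sup>2
               + (real p - 1) * (real_of_int (b i + a i) * real lam / real_of_int (b i - a i))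
             = real p * real_of_int r4))"
proof -
  interpret comm_group G by fact
  note fin = \<open>finite (carrier G)\<close> and S = \<open>SEDF G v m k lam D\<close> and p = \<open>prime p\<close>
  have sub: "D i \<subseteq> carrier G" and card: "card (D i) = k" if "i \<in> {1..m}" for i
    using S that by (simp_all add: SEDF_def)
  have disj: "\<forall>i\<in>{1..m}. \<forall>j\<in>{1..m}. i \<noteq> j \<longrightarrow> D i \<inter> D j = {}" and lam: "lam > 0"
    using S by (simp_all add: SEDF_def)
  have finD: "finite (D i)" if "i \<in> {1..m}" for i using sub[OF that] fin finite_subset by blast
  define E where "E = (\<Union>i\<in>{1..m}. D i)"
  have subE: "E \<subseteq> carrier G" unfolding E_def by (rule UN_least) (rule sub)
  have finE: "finite E" using subE fin finite_subset by blast
  have cardE: "card E = k * m"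
    using card_UN_disjoint[of "{1..m}" D] finD disj card by (simp add: E_def mult.commute)
  define s where "s \<chi> i = (\<Sum>x\<in>D i. \<chi> x)" for \<chi> :: "'a \<Rightarrow> complex" and i
  have sumE: "(\<Sum>x\<in>E. \<chi> x) = (\<Sum>i\<in>{1..m}. s \<chi> i)" for \<chi> :: "'a \<Rightarrow> complex"
    unfolding E_def s_def by (rule sum.UNION_disjoint) (use finD disj in auto)
  have eqn: "s \<chi> j * cnj ((\<Sum>i\<in>{1..m}. s \<chi> i) - s \<chi> j) = - of_nat lam"
    if "\<chi> \<in> characters G" "\<chi> \<noteq> principal_character G" "j \<in> {1..m}" for \<chi> j
  proof -
    have "(\<Sum>i\<in>{1..m}. s \<chi> i) - s \<chi> j = (\<Sum>i\<in>{1..m} - {j}. s \<chi> i)"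
      using that(3) by (simp add: sum_diff1)
    then show ?thesis using SEDF_character_equation[OF fin S that] by (simp only: s_def)
  qed
  define e where "e = multiplicity p (order G)"
  have K: "subgroup Gp G" and cK: "card Gp = p ^ e"
    using \<open>sylow_subgroup G p Gp\<close> by (simp_all add: sylow_subgroup_def e_def)
  have G0: "order G \<noteq> 0" using fin order_gt_0_iff_finite by simp
  obtain w where w: "order G = p ^ e * w" "\<not> p dvd w"
    using multiplicity_decompose'[of "order G" p] G0 p unfolding e_def
    by (metis not_prime_unit)
  have ord: "order G = card Gp * w" using w cK by simp
  have cop: "coprime (card Gp) w" using w p cK by (simp add: prime_imp_coprime)
  show ?thesis
  proof (cases "\<forall>\<chi>\<in>power_characters (card Gp). \<chi> \<noteq> principal_character G \<longrightarrow> (\<Sum>x\<in>E. \<chi> x) = 0")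
    case True
    have "card Gp dvd card E"
      by (rule card_dvd_of_power_characters_vanish[OF fin K ord cop subE]) (use True in blast)
    moreover have "1 \<in> {1..m}" using \<open>m > 2\<close> by simp
    \<comment> \<open>Any block would do; when the total is 0, the equation for the first block says
      that its value has squared norm \<open>lam\<close>.\<close>
    moreover have "(cmod (\<Sum>x\<in>D 1. \<chi> x))\<^sup>2 = of_int (int lam)"
      if "\<chi> \<in> power_characters (card Gp)" "\<chi> \<noteq> principal_character G" for \<chi>
    proof -
      have "\<chi> \<in> characters G" using that by (simp add: power_characters_def)
      moreover have "(\<Sum>i\<in>{1..m}. s \<chi> i) = 0" using True that sumE by metis
      ultimately have "s \<chi> 1 * cnj (s \<chi> 1) = of_nat lam"
        using eqn[of \<chi> 1] that(2) \<open>1 \<in> {1..m}\<close> by (simp only: diff_0) simp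
      then have "complex_of_real ((cmod (s \<chi> 1))\<^sup>2) = of_real (real lam)"
        by (simp only: complex_norm_square) simp
      then show ?thesis by (simp only: of_real_eq_iff s_def of_int_of_nat_eq)
    qed
    ultimately show ?thesis
      using power_characters_constant_norm[OF fin K ord cop sub[of 1], of "int lam"] card[of 1] cardE
      by simp
  next
    case False
    then obtain \<chi> where \<chi>: "\<chi> \<in> power_characters (card Gp)" "\<chi> \<noteq> principal_character G"
      and nz: "(\<Sum>x\<in>E. \<chi> x) \<noteq> 0" by blast
    have ch: "\<chi> \<in> characters G" and roots: "\<And>x. x \<in> carrier G \<Longrightarrow> \<chi> x ^ (p ^ e) = 1"
      using \<chi>(1) cK by (simp_all add: power_characters_def)
    have ext: "char_ext G \<chi> (gr_of_set E) = (\<Sum>x\<in>E. \<chi> x)" by (rule char_ext_gr_of_set[OF fin subE])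
    define \<sigma> where "\<sigma> = sqrt (1 + 4 * real lam / (cmod (\<Sum>x\<in>E. \<chi> x))\<^sup>2)"
    have S0: "(\<Sum>i\<in>{1..m}. s \<chi> i) \<noteq> 0" using nz sumE by simp
    note quad = character_values_quadratic[OF \<open>m > 2\<close> lam S0 eqn[OF ch \<chi>(2)],
        folded sumE, folded \<sigma>_def]
    obtain b0 a0 :: int where ab: "a0 > 0" "coprime b0 a0" "\<sigma> = b0 / a0"
      using quad(1) by (rule Rats_cases')
    \<comment> \<open>The predicate under the \<open>THE\<close> of \<open>char_pair\<close>. It
      holds exactly for the lowest terms \<open>(a0, b0)\<close> of \<open>\<sigma>\<close>, which
      therefore occur among the given pairs.\<close>
    define Q where "Q x \<longleftrightarrow> (case x of (a, b) \<Rightarrow> 0 < a \<and> a < b \<and> coprime a b \<and>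
        sqrt (1 + 4 * real lam / (cmod (char_ext G \<chi> (gr_of_set E)))\<^sup>2) = real_of_int b / real_of_int a)"
      for x :: "int \<times> int"
    have Q: "Q (a', b') \<longleftrightarrow> 0 < a' \<and> a' < b' \<and> coprime a' b' \<and> \<sigma> = b' / a'" for a' b'
      by (simp add: Q_def ext \<sigma>_def)
    have "a0 < b0" using quad(2) ab(1,3) by (simp add: less_divide_eq)
    then have "Q (a0, b0)" unfolding Q using ab by (simp add: coprime_commute)
    moreover have "x = (a0, b0)" if "Q x" for x
    proof -
      obtain a' b' where x: "x = (a', b')" by (cases x)
      then have "0 < a'" "coprime a' b'" "real_of_int b' / a' = real_of_int b0 / a0"
        using that ab(3) Q by auto
      then show ?thesis
        using rational_coprime_unique[of a' a0 b' b0] ab(1,2) x by (simp add: coprime_commute)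
    qed
    ultimately have "(THE x. Q x) = (a0, b0)" by (rule the_equality)
    then have "char_pair G lam E \<chi> = (a0, b0)" by (simp add: char_pair_def Q_def)
    moreover have "\<chi> \<in> nonvanishing_characters G E"
      using ch \<chi>(2) nz by (simp add: nonvanishing_characters_def ext)
    ultimately obtain i where i: "i \<in> {1..t}" "a i = a0" "b i = b0"
      using assms(10) unfolding E_def by fastforce
    have ba: "b i > a i" "a i > 0" and \<sigma>: "\<sigma> = real_of_int (b i) / real_of_int (a i)"
      using assms(9)[OF i(1)] ab(3) i(2,3) by auto
    have rat: "\<exists>r::int. r \<ge> int (card F) \<and> (real (card F))\<^sup>2 + (real p - 1) * n = real p * of_int r"
      if "F \<subseteq> carrier G" "(cmod (\<Sum>x\<in>F. \<chi> x))\<^sup>2 = n" "n \<in> \<rat>" for F n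
      using rational_norm_prime_power_character_sum[OF p, of F \<chi> e] that roots fin finite_subset
      by (metis subsetD)
    have nE: "(cmod (\<Sum>x\<in>E. \<chi> x))\<^sup>2 = 4 * (real_of_int (a i))\<^sup>2 * real lam
        / ((real_of_int (b i))\<^sup>2 - (real_of_int (a i))\<^sup>2)" (is "_ = ?nE")
    proof -
      have "(cmod (\<Sum>x\<in>E. \<chi> x))\<^sup>2 = 4 * real lam / (\<sigma>\<^sup>2 - 1)" by (rule quad(3))
      also have "\<dots> = ?nE" unfolding \<sigma> using ba by (simp add: power_divide divide_simps)
      finally show ?thesis .
    qed
    have \<sigma>1: "\<sigma> - 1 = real_of_int (b i - a i) / a i" "\<sigma> + 1 = real_of_int (b i + a i) / a i"
      unfolding \<sigma> using ba by (simp_all add: field_simps)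
    have neg: "real lam * (\<sigma> - 1) / (\<sigma> + 1) = real_of_int (b i - a i) * real lam / real_of_int (b i + a i)"
      unfolding \<sigma>1 using ba by simp
    have pos: "real lam * (\<sigma> + 1) / (\<sigma> - 1) = real_of_int (b i + a i) * real lam / real_of_int (b i - a i)"
      unfolding \<sigma>1 using ba by simp
    \<comment> \<open>A block with the minus sign, for (2b); \<open>j3\<close> below has the plus
      sign, for (2c).\<close>
    obtain j2 where j2: "j2 \<in> {1..m}"
      "(cmod (\<Sum>x\<in>D j2. \<chi> x))\<^sup>2 = real_of_int (b i - a i) * real lam / real_of_int (b i + a i)"
      using quad(4) unfolding neg s_def by blast
    obtain j3 where j3: "j3 \<in> {1..m}"
      "(cmod (\<Sum>x\<in>D j3. \<chi> x))\<^sup>2 = real_of_int (b i + a i) * real lam / real_of_int (b i - a i)"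
      using quad(5) unfolding pos s_def by blast
    have "\<exists>r2::int. r2 \<ge> int (k * m) \<and> (real k)\<^sup>2 * (real m)\<^sup>2 + (real p - 1) * ?nE = real p * real_of_int r2"
      using rat[OF subE nE] unfolding cardE by (simp add: power_mult_distrib)
    moreover have "\<exists>r3::int. r3 \<ge> int k \<and> (real k)\<^sup>2
        + (real p - 1) * (real_of_int (b i - a i) * real lam / real_of_int (b i + a i)) = real p * real_of_int r3"
      using rat[OF sub[OF j2(1)] j2(2)] card[OF j2(1)] by simp
    moreover have "\<exists>r4::int. (real k)\<^sup>2
        + (real p - 1) * (real_of_int (b i + a i) * real lam / real_of_int (b i - a i)) = real p * real_of_int r4"
      using rat[OF sub[OF j3(1)] j3(2)] card[OF j3(1)] by auto
    ultimately show ?thesis using i(1) by blast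
  qed
qed

end
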